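(* Let $L\ge 2$ be an integer, let $\nu$ be an integer and $\tau$ a real number, and let $\Sigma=\Sigma(L,\nu,\tau)\subset\{0,1,\dots,L\nu\}^{\mathbb Z}$ be the $L$-coloured subshift defined in the context. If $\nu\ge 2$ and $\tau\ge\frac{\log 5}{\log\nu}$, then there are $L$ distinct ergodic measures of maximal entropy on $\Sigma$.
   Context: Alphabet: $\mathcal{A}=\{0,1,\dots,L\nu\}$. For $j=1,\dots,L$ the symbols of colour $j$ are $\mathcal{A}_j=\{(j-1)\nu+1,(j-1)\nu+2,\dots,j\nu\}$, and $\Sigma_j=\mathcal{A}_j^{\mathbb Z}$ is the corresponding full $\nu$-shift; nonzero symbols are called coloured. Definition of $\Sigma$: a sequence $x\in\mathcal{A}^{\mathbb Z}$ belongs to $\Sigma$ if and only if either $x\in\bigcup_{j=1}^L\Sigma_j$ (then $x$ is called monochromatic), or the following holds. Every maximal block of consecutive coloured symbols in $x$ consists of symbols of a single colour. Any two successive such blocks $\alpha,\beta$ (i.e. separated only by zeros) are both of finite lengths $|\alpha|,|\beta|$, have colours $j$ and $j'$ with $j'=j-1$ or $j'=j+1$ (with $j,j'\in\{1,\dots,L\}$), and are separated by a string of zeros of length at least $\tau(|\alpha|+|\beta|)$. In particular, an infinitely long coloured block can only be adjacent to an infinite string of zeros. Sequences with at most one coloured block, and zeros elsewhere, are allowed. The shift is $(\sigma x)_i=x_{i+1}$, and $\Sigma$ carries the topology induced from the product topology on $\mathcal{A}^{\mathbb Z}$. A measure of maximal entropy is a $\sigma$-invariant Borel probability measure on $\Sigma$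 whose metric (Kolmogorov–Sinai) entropy equals the topological entropy of $\sigma:\Sigma\to\Sigma$. *)

theory Defs
  imports "HOL-Probability.Probability"
begin

section \<open>Entropy of a map\<close>

text \<open>
  A dynamical system is a set \<open>S\<close> with a map \<open>T\<close>, thought of as \<open>T : S \<rightarrow> S\<close>.
  For a family \<open>U\<close> of subsets of \<open>S\<close>, the \<open>n\<close>-th join is
  \<open>U \<or> T\<^sup>-\<^sup>1 U \<or> \<dots> \<or> T\<^sup>-\<^sup>(\<^sup>n\<^sup>-\<^sup>1\<^sup>) U\<close>.  It is used both for open covers and for partitions.  For a
  partition it may contain the empty set in addition to the cells of the refined partition; this
  does not change the entropy.
\<close>

definition dyn_join :: "'a set \<Rightarrow> ('a \<Rightarrow> 'a) \<Rightarrow> nat \<Rightarrow> 'a set set \<Rightarrow> 'a set set" where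
  "dyn_join S T n U = {{x \<in> S. \<forall>i<n. (T ^^ i) x \<in> c i} | c. \<forall>i<n. c i \<in> U}"

text \<open>
  Topological entropy in the sense of Adler, Konheim and McAndrew, for a compact \<open>S\<close> with the
  subspace topology (compactness is what makes finite subcovers exist).  In both notions of entropy
  below the sequence whose upper limit is taken is \<open>1/n\<close> times a subadditive sequence (for continuous
  \<open>T\<close> and for invariant measures, respectively), so that the limit exists.
\<close>

definition open_cover :: "'a::topological_space set \<Rightarrow> 'a set set \<Rightarrow> bool" where
  "open_cover S U \<longleftrightarrow> (\<forall>A\<in>U. openin (top_of_set S) A) \<and> \<Union>U = S"

definition min_subcover_card :: "'a set \<Rightarrow> 'a set set \<Rightarrow> nat" where
  "min_subcover_card S U = (LEAST k. \<exists>V\<subseteq>U. finite V \<and> card V = k \<and> \<Union>V = S)"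

definition cover_entropy :: "'a set \<Rightarrow> ('a \<Rightarrow> 'a) \<Rightarrow> 'a set set \<Rightarrow> ereal" where
  "cover_entropy S T U =
     limsup (\<lambda>n. ereal (ln (real (min_subcover_card S (dyn_join S T n U))) / real n))"

definition topological_entropy :: "'a::topological_space set \<Rightarrow> ('a \<Rightarrow> 'a) \<Rightarrow> ereal" where
  "topological_entropy S T = (SUP U\<in>{U. open_cover S U}. cover_entropy S T U)"

text \<open>The convention \<open>0 log 0 = 0\<close> holds automatically.\<close>

definition static_entropy :: "'a measure \<Rightarrow> 'a set set \<Rightarrow> real" where
  "static_entropy M P = - (\<Sum>A\<in>P. measure M A * ln (measure M A))"

definition partition_entropy :: "'a measure \<Rightarrow> ('a \<Rightarrow> 'a) \<Rightarrow> 'a set set \<Rightarrow> ereal" where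
  "partition_entropy M T P =
     limsup (\<lambda>n. ereal (static_entropy M (dyn_join (space M) T n P) / real n))"

definition metric_entropy :: "'a measure \<Rightarrow> ('a \<Rightarrow> 'a) \<Rightarrow> ereal" where
  "metric_entropy M T =
     (SUP P\<in>{P. finite P \<and> P \<subseteq> sets M \<and> partition_on (space M) P}. partition_entropy M T P)"

section \<open>Invariant measures\<close>

definition borel_prob_on :: "'a::topological_space set \<Rightarrow> 'a measure \<Rightarrow> bool" where
  "borel_prob_on S M \<longleftrightarrow> prob_space M \<and> sets M = sets (restrict_space borel S)"

definition invariant_measure :: "'a measure \<Rightarrow> ('a \<Rightarrow> 'a) \<Rightarrow> bool" where
  "invariant_measure M T \<longleftrightarrow> T \<in> measurable M M \<and> distr M M T = M"

definition ergodic_measure :: "'a measure \<Rightarrow> ('a \<Rightarrow> 'a) \<Rightarrow> bool" where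
  "ergodic_measure M T \<longleftrightarrow> invariant_measure M T \<and>
     (\<forall>A\<in>sets M. T -` A \<inter> space M = A \<longrightarrow> measure M A = 0 \<or> measure M A = 1)"

definition measure_of_maximal_entropy ::
    "'a::topological_space set \<Rightarrow> ('a \<Rightarrow> 'a) \<Rightarrow> 'a measure \<Rightarrow> bool" where
  "measure_of_maximal_entropy S T M \<longleftrightarrow>
     borel_prob_on S M \<and> invariant_measure M T \<and> metric_entropy M T = topological_entropy S T"

section \<open>The coloured subshift\<close>

text \<open>
  Bi-infinite sequences are functions of type \<open>int \<Rightarrow> nat\<close>.  The type \<open>nat\<close> is discrete and the
  function type carries the product topology.
\<close>

definition left_shift :: "(int \<Rightarrow> 'a) \<Rightarrow> int \<Rightarrow> 'a" where
  "left_shift x = (\<lambda>i. x (i + 1))"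

definition colour_symbols :: "nat \<Rightarrow> nat \<Rightarrow> nat set" where
  "colour_symbols \<nu> j = {(j - 1) * \<nu> + 1 .. j * \<nu>}"

definition full_colour_shift :: "nat \<Rightarrow> nat \<Rightarrow> (int \<Rightarrow> nat) set" where
  "full_colour_shift \<nu> j = {x. \<forall>i. x i \<in> colour_symbols \<nu> j}"

text \<open>
  A block is given by the set of its positions, a finite or infinite interval of integers.
\<close>

definition coloured_interval :: "(int \<Rightarrow> nat) \<Rightarrow> int set \<Rightarrow> bool" where
  "coloured_interval x B \<longleftrightarrow>
     B \<noteq> {} \<and> (\<forall>i\<in>B. \<forall>k\<in>B. {i..k} \<subseteq> B) \<and> (\<forall>i\<in>B. x i \<noteq> 0)"

definition coloured_block :: "(int \<Rightarrow> nat) \<Rightarrow> int set \<Rightarrow> bool" where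
  "coloured_block x B \<longleftrightarrow>
     coloured_interval x B \<and> (\<forall>C. coloured_interval x C \<and> B \<subseteq> C \<longrightarrow> C = B)"

definition gap :: "int set \<Rightarrow> int set \<Rightarrow> int set" where
  "gap B C = {m. (\<forall>i\<in>B. i < m) \<and> (\<forall>k\<in>C. m < k)}"

definition successive_blocks :: "(int \<Rightarrow> nat) \<Rightarrow> int set \<Rightarrow> int set \<Rightarrow> bool" where
  "successive_blocks x B C \<longleftrightarrow>
     coloured_block x B \<and> coloured_block x C \<and> (\<forall>i\<in>B. \<forall>k\<in>C. i < k) \<and> (\<forall>m\<in>gap B C. x m = 0)"

definition coloured_subshift :: "nat \<Rightarrow> nat \<Rightarrow> real \<Rightarrow> (int \<Rightarrow> nat) set" where
  "coloured_subshift L \<nu> \<tau> =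
     {x. (\<forall>i. x i \<in> {0..L * \<nu>}) \<and>
         (x \<in> (\<Union>j\<in>{1..L}. full_colour_shift \<nu> j) \<or>
          (\<forall>B. coloured_block x B \<longrightarrow> (\<exists>j\<in>{1..L}. x ` B \<subseteq> colour_symbols \<nu> j)) \<and>
          (\<forall>B C. successive_blocks x B C \<longrightarrow>
             finite B \<and> finite C \<and>
             (\<exists>j\<in>{1..L}. \<exists>j'\<in>{1..L}.
                x ` B \<subseteq> colour_symbols \<nu> j \<and> x ` C \<subseteq> colour_symbols \<nu> j' \<and>
                (j' = j + 1 \<or> j = j' + 1)) \<and>
             \<tau> * real (card B + card C) \<le> real (card (gap B C))))}"

end

theory Submission
  imports Defs "HOL-Real_Asymp.Real_Asymp"
begin

text \<open>
  The uniform Bernoulli measures on the \<open>L\<close> monochromatic full \<open>\<nu>\<close>-shifts are ergodic, mutually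
  singular and have entropy \<open>log \<nu>\<close>; so everything rests on the number of words of length \<open>n\<close> in the
  subshift growing no faster than \<open>\<nu>\<^sup>n\<close> up to a polynomial factor, which bounds both the topological
  entropy and the entropy of every invariant measure by \<open>log \<nu>\<close>.  To count words, weigh each symbol
  by \<open>1/\<nu>\<close>.  A coloured block of any length then has total weight \<open>1\<close>, whereas the gap between
  blocks of lengths \<open>a\<close> and \<open>b\<close> costs at most \<open>2 \<nu>\<^bsup>-\<tau>(a+b)\<^esup> \<le> 2 \<cdot> 5\<^bsup>-(a+b)\<^esup>\<close>, and the next block has at most two
  possible colours.  Since \<open>\<Sum>\<^bsub>b\<ge>1\<^esub> 4 \<cdot> 5\<^bsup>-(a+b)\<^esup> \<le> 1/5\<close>, the total weight of all continuations
  after a block is bounded.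
\<close>

subsection \<open>The local form of the defining condition\<close>

text \<open>Metric entropy is a supremum over all finite Borel partitions, while counting words only
  controls partitions into cylinders. The two are reconciled inside the entropy estimate: the cells
  of a partition are approximated by sets depending on finitely many coordinates, and the mistakes
  of this approximation along an orbit are recorded by a second random variable of arbitrarily small
  entropy per step. Both lower bounds come from one count: under a uniform Bernoulli measure every
  cylinder of length n has measure 0 or 1/\<nu>^n, so a cover by such cylinders has at least \<nu>^n
  members. The count of words has to cope with windows that cut blocks at their ends. The gap
  inequality is monotone in the block lengths, so it remains true for the visible parts, and
  everything after the first visible block obeys a closed recursion in visible length and colour.
  Only the first block is unconstrained from the left; the choice of its place, length and colour is
  the source of the polynomial factor.\<close>

lemma colour_symbols_disjoint:
  assumes "s \<in> colour_symbols \<nu> j" "s \<in> colour_symbols \<nu> j'" "1 \<le> j" "1 \<le> j'"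
  shows "j = j'"
proof (rule ccontr)
  have *: False if "a < b" "s \<le> a * \<nu>" "(b - 1) * \<nu> + 1 \<le> s" for a b :: nat
  proof -
    have "a * \<nu> \<le> (b - 1) * \<nu>" using that(1) by (intro mult_right_mono) auto
    then show False using that by linarith
  qed
  assume "j \<noteq> j'"
  then consider "j < j'" | "j' < j" by linarith
  then show False
    using assms *[of j j'] *[of j' j] by cases (auto simp: colour_symbols_def)
qed

lemma zero_notin_colour_symbols [simp]: "0 \<notin> colour_symbols \<nu> j"
  by (simp add: colour_symbols_def)

lemma finite_colour_symbols [simp]: "finite (colour_symbols \<nu> j)"
  by (simp add: colour_symbols_def)

lemma card_colour_symbols:
  assumes "1 \<le> j"
  shows "card (colour_symbols \<nu> j) = \<nu>"
proof -
  have "j * \<nu> = (j - 1) * \<nu> + \<nu>" using assms by (cases j) auto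
  then show ?thesis by (simp add: colour_symbols_def)
qed

lemma colour_symbols_le:
  assumes "s \<in> colour_symbols \<nu> j" "j \<le> L"
  shows "s \<le> L * \<nu>"
proof -
  have "s \<le> j * \<nu>" using assms by (simp add: colour_symbols_def)
  also have "\<dots> \<le> L * \<nu>" using assms by simp
  finally show ?thesis .
qed

definition monochromatic_on :: "nat \<Rightarrow> nat \<Rightarrow> (int \<Rightarrow> nat) \<Rightarrow> int set \<Rightarrow> bool" where
  "monochromatic_on L \<nu> x B \<longleftrightarrow> (\<exists>j\<in>{1..L}. x ` B \<subseteq> colour_symbols \<nu> j)"

text \<open>Like \<open>monochromatic_on\<close>, this passes to subsets of the position sets; that
  is what allows blocks to be replaced by finite subintervals.\<close>

definition adjacent_colours :: "nat \<Rightarrow> nat \<Rightarrow> (int \<Rightarrow> nat) \<Rightarrow> int set \<Rightarrow> int set \<Rightarrow> bool" where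
  "adjacent_colours L \<nu> x B C \<longleftrightarrow>
     (\<exists>j\<in>{1..L}. \<exists>j'\<in>{1..L}.
        x ` B \<subseteq> colour_symbols \<nu> j \<and> x ` C \<subseteq> colour_symbols \<nu> j' \<and> (j' = j + 1 \<or> j = j' + 1))"

text \<open>
  The local form of the defining condition: it only refers to finite subintervals of blocks, which is
  what makes the subshift closed and what is inherited by finite windows.
\<close>

definition locally_admissible :: "nat \<Rightarrow> nat \<Rightarrow> real \<Rightarrow> (int \<Rightarrow> nat) \<Rightarrow> bool" where
  "locally_admissible L \<nu> \<tau> x \<longleftrightarrow>
     (\<forall>i. x i \<le> L * \<nu>) \<and>
     (\<forall>a b. a \<le> b \<and> (\<forall>i\<in>{a..b}. x i \<noteq> 0) \<longrightarrow> monochromatic_on L \<nu> x {a..b}) \<and>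
     (\<forall>a b c d. a \<le> b \<and> b + 1 < c \<and> c \<le> d \<and> (\<forall>i\<in>{a..b}. x i \<noteq> 0) \<and>
        (\<forall>i\<in>{b<..<c}. x i = 0) \<and> (\<forall>i\<in>{c..d}. x i \<noteq> 0) \<longrightarrow>
        adjacent_colours L \<nu> x {a..b} {c..d} \<and>
        \<tau> * real_of_int ((b - a + 1) + (d - c + 1)) \<le> real_of_int (c - b - 1))"

lemma locally_admissibleD:
  assumes "locally_admissible L \<nu> \<tau> x"
  shows "x i \<le> L * \<nu>"
    and "a \<le> b \<Longrightarrow> (\<And>i. i \<in> {a..b} \<Longrightarrow> x i \<noteq> 0) \<Longrightarrow> monochromatic_on L \<nu> x {a..b}"
    and "a \<le> b \<Longrightarrow> b + 1 < c \<Longrightarrow> c \<le> d \<Longrightarrow> (\<And>i. i \<in> {a..b} \<Longrightarrow> x i \<noteq> 0) \<Longrightarrow>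
         (\<And>i. i \<in> {b<..<c} \<Longrightarrow> x i = 0) \<Longrightarrow> (\<And>i. i \<in> {c..d} \<Longrightarrow> x i \<noteq> 0) \<Longrightarrow>
         adjacent_colours L \<nu> x {a..b} {c..d} \<and>
         \<tau> * real_of_int ((b - a + 1) + (d - c + 1)) \<le> real_of_int (c - b - 1)"
  using assms unfolding locally_admissible_def by blast+

lemma locally_admissibleI:
  assumes "\<And>i. x i \<le> L * \<nu>"
    and "\<And>a b. a \<le> b \<Longrightarrow> \<forall>i\<in>{a..b}. x i \<noteq> 0 \<Longrightarrow> monochromatic_on L \<nu> x {a..b}"
    and "\<And>a b c d. a \<le> b \<Longrightarrow> \<forall>i\<in>{a..b}. x i \<noteq> 0 \<Longrightarrow> b + 1 < c \<Longrightarrow>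
         \<forall>i\<in>{b<..<c}. x i = 0 \<Longrightarrow> c \<le> d \<Longrightarrow> \<forall>i\<in>{c..d}. x i \<noteq> 0 \<Longrightarrow>
         adjacent_colours L \<nu> x {a..b} {c..d} \<and>
         \<tau> * real_of_int ((b - a + 1) + (d - c + 1)) \<le> real_of_int (c - b - 1)"
  shows "locally_admissible L \<nu> \<tau> x"
  unfolding locally_admissible_def using assms by blast

lemma coloured_interval_union:
  assumes "coloured_interval x B" "coloured_interval x C" "a \<in> B" "a \<in> C"
  shows "coloured_interval x (B \<union> C)"
proof -
  have "{i..k} \<subseteq> B \<union> C" if "i \<in> B \<union> C" "k \<in> B \<union> C" for i k
  proof
    fix m assume m: "m \<in> {i..k}"
    have "m \<in> {i..a} \<or> m \<in> {a..k}" using m by auto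
    moreover have "{i..a} \<subseteq> B \<union> C" "{a..k} \<subseteq> B \<union> C"
      using assms that unfolding coloured_interval_def by blast+
    ultimately show "m \<in> B \<union> C" by blast
  qed
  with assms show ?thesis unfolding coloured_interval_def by blast
qed

text \<open>The union of all coloured intervals containing \<open>I\<close> is again a coloured
  interval, because any two of them meet in a point of \<open>I\<close>; it is the maximal
  one.\<close>

lemma coloured_block_exists:
  assumes "coloured_interval x I"
  obtains B where "coloured_block x B" "I \<subseteq> B"
proof -
  define F where "F = {C. coloured_interval x C \<and> I \<subseteq> C}"
  obtain a where a: "a \<in> I" using assms by (auto simp: coloured_interval_def)
  have "coloured_interval x (\<Union>F)"
    unfolding coloured_interval_def
  proof (intro conjI ballI)
    show "\<Union>F \<noteq> {}" using assms a by (auto simp: F_def)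
  next
    fix i k assume "i \<in> \<Union>F" "k \<in> \<Union>F"
    then obtain C D where CD: "C \<in> F" "D \<in> F" "i \<in> C" "k \<in> D" by blast
    then have "coloured_interval x (C \<union> D)"
      using a by (intro coloured_interval_union[of x C D a]) (auto simp: F_def)
    then have "{i..k} \<subseteq> C \<union> D" using CD unfolding coloured_interval_def by blast
    then show "{i..k} \<subseteq> \<Union>F" using CD by blast
  next
    fix i assume "i \<in> \<Union>F"
    then show "x i \<noteq> 0" by (auto simp: F_def coloured_interval_def)
  qed
  moreover have "I \<subseteq> \<Union>F" using assms by (auto simp: F_def)
  ultimately have "coloured_block x (\<Union>F)"
    unfolding coloured_block_def F_def by blast
  then show ?thesis using that \<open>I \<subseteq> \<Union>F\<close> by blast
qed

lemma coloured_interval_atLeastAtMost: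
  assumes "a \<le> b" "\<And>i. i \<in> {a..b} \<Longrightarrow> x i \<noteq> 0"
  shows "coloured_interval x {a..b}"
  using assms by (auto simp: coloured_interval_def)

text \<open>In a sequence without zeros the condition on gaps is vacuous: \<open>b + 1 < c\<close>
  would make position \<open>b + 1\<close> a zero.\<close>

lemma full_colour_shift_locally_admissible:
  assumes "x \<in> full_colour_shift \<nu> j" "j \<in> {1..L}"
  shows "locally_admissible L \<nu> \<tau> x"
proof -
  have x: "x i \<in> colour_symbols \<nu> j" for i using assms by (auto simp: full_colour_shift_def)
  then have nz: "x i \<noteq> 0" for i by (metis zero_notin_colour_symbols)
  have "\<not> (b + 1 < c \<and> (\<forall>i\<in>{b<..<c}. x i = 0))" for b c :: int
  proof
    assume "b + 1 < c \<and> (\<forall>i\<in>{b<..<c}. x i = 0)"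
    then have "x (b + 1) = 0" by auto
    then show False using nz by blast
  qed
  moreover have "monochromatic_on L \<nu> x {a..b}" for a b
    unfolding monochromatic_on_def using x assms(2) by blast
  moreover have "x i \<le> L * \<nu>" for i using colour_symbols_le[OF x] assms(2) by auto
  ultimately show ?thesis unfolding locally_admissible_def by blast
qed

text \<open>Both finite intervals are enlarged to maximal blocks. The zeros at \<open>b + 1\<close>
  and \<open>c - 1\<close> stop these blocks, so the gap stays the same while the lengths can only
  grow; since \<tau> is positive, the inequality for the blocks is the stronger one.\<close>

lemma block_condition_imp_local:
  assumes range: "\<And>i. x i \<le> L * \<nu>" and "0 < \<tau>"
    and mono: "\<And>B. coloured_block x B \<Longrightarrow> monochromatic_on L \<nu> x B"
    and succ: "\<And>B C. successive_blocks x B C \<Longrightarrow> finite B \<and> finite C \<and>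
      adjacent_colours L \<nu> x B C \<and> \<tau> * real (card B + card C) \<le> real (card (gap B C))"
  shows "locally_admissible L \<nu> \<tau> x"
proof -
  have L1: "monochromatic_on L \<nu> x {a..b}" if "a \<le> b" "\<forall>i\<in>{a..b}. x i \<noteq> 0" for a b
  proof -
    have "coloured_interval x {a..b}" using that by (intro coloured_interval_atLeastAtMost) auto
    then obtain B where "coloured_block x B" "{a..b} \<subseteq> B" by (rule coloured_block_exists)
    then show ?thesis using mono unfolding monochromatic_on_def by blast
  qed
  have L2: "adjacent_colours L \<nu> x {a..b} {c..d} \<and>
      \<tau> * real_of_int ((b - a + 1) + (d - c + 1)) \<le> real_of_int (c - b - 1)"
    if ab: "a \<le> b" "\<forall>i\<in>{a..b}. x i \<noteq> 0" and bc: "b + 1 < c" "\<forall>i\<in>{b<..<c}. x i = 0"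
      and cd: "c \<le> d" "\<forall>i\<in>{c..d}. x i \<noteq> 0" for a b c d
  proof -
  obtain B where B: "coloured_block x B" "{a..b} \<subseteq> B"
    using ab coloured_block_exists coloured_interval_atLeastAtMost by metis
  obtain C where C: "coloured_block x C" "{c..d} \<subseteq> C"
    using cd coloured_block_exists coloured_interval_atLeastAtMost by metis
  have Bi: "coloured_interval x B" and Ci: "coloured_interval x C"
    using B C by (auto simp: coloured_block_def)
  have bB: "b \<in> B" and cC: "c \<in> C" using B C ab cd by auto
  have zero: "x (b + 1) = 0" "x (c - 1) = 0" using bc by auto
  have B_le: "i \<le> b" if "i \<in> B" for i
  proof (rule ccontr)
    assume "\<not> i \<le> b"
    then have "b + 1 \<in> {b..i}" by simp
    then have "b + 1 \<in> B" using Bi bB that unfolding coloured_interval_def by blast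
    then show False using Bi zero unfolding coloured_interval_def by blast
  qed
  have C_ge: "c \<le> i" if "i \<in> C" for i
  proof (rule ccontr)
    assume "\<not> c \<le> i"
    then have "c - 1 \<in> {i..c}" by simp
    then have "c - 1 \<in> C" using Ci cC that unfolding coloured_interval_def by blast
    then show False using Ci zero unfolding coloured_interval_def by blast
  qed
  have gap: "gap B C = {b<..<c}"
    using B_le C_ge bB cC by (fastforce simp: gap_def)
  have "successive_blocks x B C"
    unfolding successive_blocks_def gap using B C B_le C_ge bc by fastforce
  note S = succ[OF this]
  have "x ` {a..b} \<subseteq> x ` B" "x ` {c..d} \<subseteq> x ` C"
    using B C by (simp_all add: image_mono)
  then have "adjacent_colours L \<nu> x {a..b} {c..d}"
    using S unfolding adjacent_colours_def by (meson subset_trans)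
  moreover have "card {a..b} \<le> card B" "card {c..d} \<le> card C"
    using S B C by (simp_all only: card_mono)
  then have "\<tau> * real (card {a..b} + card {c..d}) \<le> \<tau> * real (card B + card C)"
    using \<open>0 < \<tau>\<close> by (intro mult_left_mono) auto
  with S have "\<tau> * real (card {a..b} + card {c..d}) \<le> real (card {b<..<c})"
    unfolding gap by linarith
  then have "\<tau> * real_of_int ((b - a + 1) + (d - c + 1)) \<le> real_of_int (c - b - 1)"
    using ab bc cd by (simp add: algebra_simps)
  ultimately show ?thesis ..
  qed
  show ?thesis
  proof (rule locally_admissibleI, goal_cases)
    case 1
    show ?case by (rule range)
  next
    case 2
    then show ?case by (rule L1)
  next
    case 3
    then show ?case by (rule L2)
  qed
qed


text \<open>Two positions of a block, even of an infinite one, lie in a common finite subinterval,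
  and a symbol determines its colour.\<close>

lemma locally_admissible_same_colour:
  assumes "locally_admissible L \<nu> \<tau> x" "coloured_interval x B" "i \<in> B" "k \<in> B"
    and "x i \<in> colour_symbols \<nu> j" "j \<in> {1..L}"
  shows "x k \<in> colour_symbols \<nu> j"
proof -
  have "{min i k..max i k} \<subseteq> B"
    using assms(2-4) unfolding coloured_interval_def by (metis max_def min_def)
  then have "x m \<noteq> 0" if "m \<in> {min i k..max i k}" for m
    using assms(2) that unfolding coloured_interval_def by blast
  then have "monochromatic_on L \<nu> x {min i k..max i k}"
    by (intro locally_admissibleD(2)[OF assms(1)]) simp_all
  then obtain j' where j': "j' \<in> {1..L}" "x ` {min i k..max i k} \<subseteq> colour_symbols \<nu> j'"
    unfolding monochromatic_on_def by blast
  moreover have "i \<in> {min i k..max i k}" "k \<in> {min i k..max i k}" by auto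
  ultimately have "x i \<in> colour_symbols \<nu> j'" "x k \<in> colour_symbols \<nu> j'" by blast+
  then show ?thesis using assms(5,6) j'(1) colour_symbols_disjoint[of "x i" \<nu> j j'] by auto
qed

lemma locally_admissible_monochromatic:
  assumes "locally_admissible L \<nu> \<tau> x" "coloured_interval x B"
  shows "monochromatic_on L \<nu> x B"
proof -
  obtain b where b: "b \<in> B" "x b \<noteq> 0" using assms(2) by (auto simp: coloured_interval_def)
  have "monochromatic_on L \<nu> x {b..b}"
    using b by (intro locally_admissibleD(2)[OF assms(1)]) auto
  then obtain j where "j \<in> {1..L}" "x b \<in> colour_symbols \<nu> j"
    by (auto simp: monochromatic_on_def)
  then show ?thesis
    using locally_admissible_same_colour[OF assms b(1)] unfolding monochromatic_on_def by blast
qed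

text \<open>Finiteness of successive blocks is not part of the local condition but follows from it:
  the gap between two blocks has a fixed finite length, and it bounds \<tau> times the length of
  every pair of subintervals adjacent to it.\<close>

lemma locally_admissible_successive:
  assumes adm: "locally_admissible L \<nu> \<tau> x" and "0 < \<tau>" and succ: "successive_blocks x B C"
  shows "finite B \<and> finite C \<and> adjacent_colours L \<nu> x B C \<and>
    \<tau> * real (card B + card C) \<le> real (card (gap B C))"
proof -
  have Bi: "coloured_interval x B" and Ci: "coloured_interval x C"
    and lt: "\<And>i k. i \<in> B \<Longrightarrow> k \<in> C \<Longrightarrow> i < k"
    and zero: "\<And>m. m \<in> gap B C \<Longrightarrow> x m = 0"
    using succ by (auto simp: successive_blocks_def coloured_block_def)
  obtain b0 c0 where b0: "b0 \<in> B" and c0: "c0 \<in> C"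
    using Bi Ci by (auto simp: coloured_interval_def)
  have icB: "{i..k} \<subseteq> B" if "i \<in> B" "k \<in> B" for i k
    using Bi that unfolding coloured_interval_def by blast
  have icC: "{i..k} \<subseteq> C" if "i \<in> C" "k \<in> C" for i k
    using Ci that unfolding coloured_interval_def by blast
  \<comment> \<open>\<open>B\<close> may still extend infinitely to the left and \<open>C\<close> to
    the right, so the facing ends are extracted from the parts beyond \<open>b0\<close> and before
    \<open>c0\<close>, which are finite since \<open>B\<close> lies to the left of
    \<open>C\<close>.\<close>
  define b where "b = Max (B \<inter> {b0..})"
  define c where "c = Min (C \<inter> {..c0})"
  have finB: "finite (B \<inter> {b0..})"
    by (rule finite_subset[of _ "{b0..c0}"]) (use lt[OF _ c0] in \<open>force+\<close>)
  have finC: "finite (C \<inter> {..c0})"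
    by (rule finite_subset[of _ "{b0..c0}"]) (use lt[OF b0] in \<open>force+\<close>)
  have "b \<in> B \<inter> {b0..}" unfolding b_def by (rule Max_in) (use finB b0 in auto)
  then have b: "b \<in> B" "b0 \<le> b" by auto
  have "c \<in> C \<inter> {..c0}" unfolding c_def by (rule Min_in) (use finC c0 in auto)
  then have c: "c \<in> C" "c \<le> c0" by auto
  have b_max: "i \<le> b" if "i \<in> B" for i
  proof (cases "b0 \<le> i")
    case True
    then show ?thesis unfolding b_def using finB that by (intro Max_ge) auto
  next
    case False
    then show ?thesis using b by linarith
  qed
  have c_min: "c \<le> i" if "i \<in> C" for i
  proof (cases "i \<le> c0")
    case True
    then show ?thesis unfolding c_def using finC that by (intro Min_le) auto
  next
    case False
    then show ?thesis using c by linarith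
  qed
  have gap: "gap B C = {b<..<c}"
    using b c b_max c_min by (fastforce simp: gap_def)
  \<comment> \<open>Were the blocks to touch, their union would contradict the maximality of
    \<open>B\<close>.\<close>
  have bc: "b + 1 < c"
  proof (rule ccontr)
    assume "\<not> b + 1 < c"
    with lt[OF b(1) c(1)] have c_eq: "c = b + 1" by linarith
    have "x b \<noteq> 0" "x c \<noteq> 0" using Bi Ci b c by (auto simp: coloured_interval_def)
    moreover have "m = b \<or> m = c" if "m \<in> {b..c}" for m using that c_eq by auto
    ultimately have "coloured_interval x {b..c}"
      by (intro coloured_interval_atLeastAtMost) (use c_eq in auto)
    then have "coloured_interval x (B \<union> {b..c})"
      by (rule coloured_interval_union[OF Bi _ b(1)]) (simp add: c_eq)
    moreover have "coloured_block x B" using succ by (simp add: successive_blocks_def)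
    ultimately have eq: "B \<union> {b..c} = B"
      unfolding coloured_block_def by (meson Un_upper1)
    have "c \<in> B \<union> {b..c}" by (simp add: c_eq)
    then have "c \<in> B" unfolding eq .
    then show False using lt[OF _ c(1)] by blast
  qed
  have key: "adjacent_colours L \<nu> x {a..b} {c..d} \<and>
      \<tau> * real_of_int ((b - a + 1) + (d - c + 1)) \<le> real_of_int (c - b - 1)"
    if "a \<in> B" "d \<in> C" for a d
  proof (rule locally_admissibleD(3)[OF adm _ bc])
    show "a \<le> b" "c \<le> d" using that b_max c_min by auto
    show "x i \<noteq> 0" if "i \<in> {a..b}" for i
      using icB[OF \<open>a \<in> B\<close> b(1)] that Bi unfolding coloured_interval_def by blast
    show "x i \<noteq> 0" if "i \<in> {c..d}" for i
      using icC[OF c(1) \<open>d \<in> C\<close>] that Ci unfolding coloured_interval_def by blast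
    show "x i = 0" if "i \<in> {b<..<c}" for i using zero that by (simp add: gap)
  qed
  \<comment> \<open>The length of the gap divided by \<tau> bounds the joint length of all
    admissible subintervals, independently of their outer ends \<open>a\<close> and
    \<open>d\<close>.\<close>
  obtain K :: int where K: "real_of_int (c - b) / \<tau> < real_of_int K" using ex_less_of_int by blast
  have bound: "b - a + (d - c) < K" if "a \<in> B" "d \<in> C" for a d
  proof -
    have "\<tau> * real_of_int ((b - a + 1) + (d - c + 1)) \<le> real_of_int (c - b - 1)"
      using key[OF that] by blast
    then have "real_of_int ((b - a + 1) + (d - c + 1)) \<le> real_of_int (c - b - 1) / \<tau>"
      using \<open>0 < \<tau>\<close> by (simp add: field_simps)
    also have "\<dots> \<le> real_of_int (c - b) / \<tau>" using \<open>0 < \<tau>\<close> by (simp add: divide_right_mono)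
    also note K
    finally have "(b - a + 1) + (d - c + 1) < K" by (simp only: of_int_less_iff)
    then show ?thesis by linarith
  qed
  have fB: "finite B"
    by (rule finite_subset[of _ "{b - K..b}"]) (use bound[OF _ c(1)] b_max in \<open>force+\<close>)
  have fC: "finite C"
    by (rule finite_subset[of _ "{c..c + K}"]) (use bound[OF b(1)] c_min in \<open>force+\<close>)
  define a where "a = Min B"
  define d where "d = Max C"
  have a: "a \<in> B" unfolding a_def using fB b by (intro Min_in) auto
  have d: "d \<in> C" unfolding d_def using fC c by (intro Max_in) auto
  have B_eq: "B = {a..b}"
    using icB[OF a b(1)] b_max fB by (auto simp: a_def)
  have C_eq: "C = {c..d}"
    using icC[OF c(1) d] c_min fC by (auto simp: d_def)
  have "a \<le> b" "c \<le> d" using a d b_max c_min by auto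
  then have "real (card B + card C) = real_of_int ((b - a + 1) + (d - c + 1))"
    by (simp_all add: B_eq C_eq)
  moreover have "real (card (gap B C)) = real_of_int (c - b - 1)" unfolding gap using bc by simp
  ultimately show ?thesis using key[OF a d] fB fC B_eq C_eq by metis
qed

text \<open>The alternative for monochromatic sequences disappears: these are locally admissible,
  and every locally admissible sequence satisfies the block alternative.\<close>

lemma coloured_subshift_iff:
  assumes "0 < \<tau>"
  shows "x \<in> coloured_subshift L \<nu> \<tau> \<longleftrightarrow> locally_admissible L \<nu> \<tau> x"
proof
  assume "x \<in> coloured_subshift L \<nu> \<tau>"
  then consider j where "j \<in> {1..L}" "x \<in> full_colour_shift \<nu> j"
    | "\<And>i. x i \<le> L * \<nu>" "\<And>B. coloured_block x B \<Longrightarrow> monochromatic_on L \<nu> x B"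
      "\<And>B C. successive_blocks x B C \<Longrightarrow> finite B \<and> finite C \<and>
        adjacent_colours L \<nu> x B C \<and> \<tau> * real (card B + card C) \<le> real (card (gap B C))"
    unfolding coloured_subshift_def monochromatic_on_def adjacent_colours_def
    by (simp only: mem_Collect_eq UN_iff) (metis atLeastAtMost_iff)
  then show "locally_admissible L \<nu> \<tau> x"
  proof cases
    case 1
    then show ?thesis using full_colour_shift_locally_admissible by blast
  next
    case 2
    then show ?thesis using assms by (intro block_condition_imp_local) blast+
  qed
next
  assume x: "locally_admissible L \<nu> \<tau> x"
  then have range: "\<forall>i. x i \<in> {0..L * \<nu>}" using locally_admissibleD(1)[OF x] by simp
  have mono: "\<forall>B. coloured_block x B \<longrightarrow> (\<exists>j\<in>{1..L}. x ` B \<subseteq> colour_symbols \<nu> j)"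
    using locally_admissible_monochromatic[OF x]
    unfolding coloured_block_def monochromatic_on_def by blast
  show "x \<in> coloured_subshift L \<nu> \<tau>"
    unfolding coloured_subshift_def
  proof (rule CollectI, rule conjI[OF range], rule disjI2, rule conjI[OF mono], intro allI impI)
    fix B C assume "successive_blocks x B C"
    from locally_admissible_successive[OF x assms this]
    show "finite B \<and> finite C \<and>
       (\<exists>j\<in>{1..L}. \<exists>j'\<in>{1..L}. x ` B \<subseteq> colour_symbols \<nu> j \<and> x ` C \<subseteq> colour_symbols \<nu> j' \<and>
         (j' = j + 1 \<or> j = j' + 1)) \<and> \<tau> * real (card B + card C) \<le> real (card (gap B C))"
      unfolding adjacent_colours_def .
  qed
qed

lemma full_colour_shift_subset:
  assumes "0 < \<tau>" "j \<in> {1..L}"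
  shows "full_colour_shift \<nu> j \<subseteq> coloured_subshift L \<nu> \<tau>"
  by (simp add: subset_iff coloured_subshift_iff[OF assms(1)]
      full_colour_shift_locally_admissible[OF _ assms(2)])

section \<open>Shift invariance of the subshift\<close>

lemma locally_admissible_translate:
  assumes "locally_admissible L \<nu> \<tau> x"
  shows "locally_admissible L \<nu> \<tau> (\<lambda>i. x (i + p))"
proof -
  have img: "(\<lambda>i. x (i + p)) ` {a..b} = x ` {a + p..b + p}" for a b
  proof -
    have "(\<lambda>i. i + p) ` {a..b} = {a + p..b + p}" by simp
    then show ?thesis by (metis image_image)
  qed
  have nz: "x i \<noteq> 0" if "\<forall>i\<in>{a..b}. x (i + p) \<noteq> 0" "i \<in> {a + p..b + p}" for a b i
    using bspec[OF that(1), of "i - p"] that(2) by simp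
  have z: "x i = 0" if "\<forall>i\<in>{b<..<c}. x (i + p) = 0" "i \<in> {b + p<..<c + p}" for b c i
    using bspec[OF that(1), of "i - p"] that(2) by simp
  have L1: "monochromatic_on L \<nu> (\<lambda>i. x (i + p)) {a..b}"
    if "a \<le> b" "\<forall>i\<in>{a..b}. x (i + p) \<noteq> 0" for a b
    unfolding monochromatic_on_def img
    by (rule locally_admissibleD(2)[OF assms, unfolded monochromatic_on_def])
      (simp_all add: that(1) nz[OF that(2)])
  have L2: "adjacent_colours L \<nu> (\<lambda>i. x (i + p)) {a..b} {c..d} \<and>
      \<tau> * real_of_int ((b - a + 1) + (d - c + 1)) \<le> real_of_int (c - b - 1)"
    if h: "a \<le> b" "\<forall>i\<in>{a..b}. x (i + p) \<noteq> 0" "b + 1 < c"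
      "\<forall>i\<in>{b<..<c}. x (i + p) = 0" "c \<le> d" "\<forall>i\<in>{c..d}. x (i + p) \<noteq> 0" for a b c d
  proof -
    have "adjacent_colours L \<nu> x {a + p..b + p} {c + p..d + p} \<and>
      \<tau> * real_of_int ((b + p - (a + p) + 1) + (d + p - (c + p) + 1)) \<le>
        real_of_int (c + p - (b + p) - 1)"
      by (rule locally_admissibleD(3)[OF assms])
        (simp_all add: h(1,3,5) nz[OF h(2)] nz[OF h(6)] z[OF h(4)])
    then show ?thesis unfolding adjacent_colours_def img by simp
  qed
  show ?thesis
  proof (rule locally_admissibleI, goal_cases)
    case 1
    show ?case by (rule locally_admissibleD(1)[OF assms])
  next
    case 2
    then show ?case by (rule L1)
  next
    case 3
    then show ?case by (rule L2)
  qed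
qed

lemma left_shift_funpow: "(left_shift ^^ n) x = (\<lambda>i. x (i + int n))"
proof (induction n)
  case (Suc n)
  have "(left_shift ^^ Suc n) x = left_shift ((left_shift ^^ n) x)" by simp
  also have "\<dots> = (\<lambda>i. x (i + int (Suc n)))"
    unfolding Suc.IH by (simp add: left_shift_def algebra_simps)
  finally show ?case .
qed simp

lemma left_shift_in_coloured_subshift:
  assumes "0 < \<tau>" "x \<in> coloured_subshift L \<nu> \<tau>"
  shows "left_shift x \<in> coloured_subshift L \<nu> \<tau>"
  using assms locally_admissible_translate[of L \<nu> \<tau> x 1]
  by (simp add: coloured_subshift_iff left_shift_def)

lemma left_shift_funpow_in_coloured_subshift:
  assumes "0 < \<tau>" "x \<in> coloured_subshift L \<nu> \<tau>"
  shows "(left_shift ^^ n) x \<in> coloured_subshift L \<nu> \<tau>"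
  by (induction n) (use assms left_shift_in_coloured_subshift in auto)

section \<open>Closedness and compactness of the subshift\<close>

text \<open>Around each point of \<open>S\<close> the cylinder fixing the coordinates in
  \<open>J\<close> is open, coordinates being discrete. This is also the source of Borel
  measurability for all cylinder-like sets below.\<close>

lemma open_finite_window:
  fixes S :: "('i \<Rightarrow> 'a::discrete_topology) set"
  assumes "finite J" "\<And>x y. x \<in> S \<Longrightarrow> (\<And>i. i \<in> J \<Longrightarrow> y i = x i) \<Longrightarrow> y \<in> S"
  shows "open S"
proof (subst open_subopen, intro ballI)
  fix x assume "x \<in> S"
  have "open (\<Inter>i\<in>J. (\<lambda>y. y i) -` {x i})"
    using assms(1) by (intro open_INT ballI open_vimage) (simp_all add: discrete_topology_class.open_discrete)
  moreover have "x \<in> (\<Inter>i\<in>J. (\<lambda>y. y i) -` {x i})" by simp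
  moreover have "(\<Inter>i\<in>J. (\<lambda>y. y i) -` {x i}) \<subseteq> S" using assms(2)[OF \<open>x \<in> S\<close>] by auto
  ultimately show "\<exists>T. open T \<and> x \<in> T \<and> T \<subseteq> S" by blast
qed

lemma closed_finite_window:
  fixes P :: "('i \<Rightarrow> 'a::discrete_topology) \<Rightarrow> bool"
  assumes "finite J" "\<And>x y. (\<And>i. i \<in> J \<Longrightarrow> y i = x i) \<Longrightarrow> P x = P y"
  shows "closed {x. P x}"
  unfolding closed_def
proof (rule open_finite_window[OF assms(1)])
  fix x y assume "x \<in> - {x. P x}" and eq: "\<And>i. i \<in> J \<Longrightarrow> y i = x i"
  then show "y \<in> - {x. P x}" using assms(2)[of y x, OF eq] by simp
qed

text \<open>Each single instance of the local condition restricts finitely many coordinates and is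
  therefore closed; the subshift is the intersection of all instances.\<close>

lemma closed_coloured_subshift:
  assumes "0 < \<tau>"
  shows "closed (coloured_subshift L \<nu> \<tau>)"
proof -
  have c1: "closed {x :: int \<Rightarrow> nat. x i \<le> L * \<nu>}" for i
    by (rule closed_finite_window[of "{i}"]) auto
  have c2: "closed {x :: int \<Rightarrow> nat. a \<le> b \<and> (\<forall>i\<in>{a..b}. x i \<noteq> 0) \<longrightarrow>
      monochromatic_on L \<nu> x {a..b}}" for a b
  proof (rule closed_finite_window[of "{a..b}"])
    fix x y :: "int \<Rightarrow> nat" assume eq: "\<And>i. i \<in> {a..b} \<Longrightarrow> y i = x i"
    then have "y ` {a..b} = x ` {a..b}" by (intro image_cong) auto
    then show "(a \<le> b \<and> (\<forall>i\<in>{a..b}. x i \<noteq> 0) \<longrightarrow> monochromatic_on L \<nu> x {a..b}) =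
       (a \<le> b \<and> (\<forall>i\<in>{a..b}. y i \<noteq> 0) \<longrightarrow> monochromatic_on L \<nu> y {a..b})"
      using eq by (simp add: monochromatic_on_def)
  qed simp
  have c3: "closed {x :: int \<Rightarrow> nat. a \<le> b \<and> b + 1 < c \<and> c \<le> d \<and> (\<forall>i\<in>{a..b}. x i \<noteq> 0) \<and>
        (\<forall>i\<in>{b<..<c}. x i = 0) \<and> (\<forall>i\<in>{c..d}. x i \<noteq> 0) \<longrightarrow>
        adjacent_colours L \<nu> x {a..b} {c..d} \<and>
        \<tau> * real_of_int ((b - a + 1) + (d - c + 1)) \<le> real_of_int (c - b - 1)}" for a b c d
  proof (rule closed_finite_window[of "{a..d}"])
    fix x y :: "int \<Rightarrow> nat" assume eq: "\<And>i. i \<in> {a..d} \<Longrightarrow> y i = x i"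
    show "(a \<le> b \<and> b + 1 < c \<and> c \<le> d \<and> (\<forall>i\<in>{a..b}. x i \<noteq> 0) \<and>
        (\<forall>i\<in>{b<..<c}. x i = 0) \<and> (\<forall>i\<in>{c..d}. x i \<noteq> 0) \<longrightarrow>
        adjacent_colours L \<nu> x {a..b} {c..d} \<and>
        \<tau> * real_of_int ((b - a + 1) + (d - c + 1)) \<le> real_of_int (c - b - 1)) =
      (a \<le> b \<and> b + 1 < c \<and> c \<le> d \<and> (\<forall>i\<in>{a..b}. y i \<noteq> 0) \<and>
        (\<forall>i\<in>{b<..<c}. y i = 0) \<and> (\<forall>i\<in>{c..d}. y i \<noteq> 0) \<longrightarrow>
        adjacent_colours L \<nu> y {a..b} {c..d} \<and>
        \<tau> * real_of_int ((b - a + 1) + (d - c + 1)) \<le> real_of_int (c - b - 1))"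
    \<comment> \<open>Only for ordered endpoints do the three intervals lie in the window
      \<open>{a..d}\<close>; otherwise both implications hold vacuously.\<close>
    proof (cases "a \<le> b \<and> b + 1 < c \<and> c \<le> d")
      case True
      then have "y ` {a..b} = x ` {a..b}" "y ` {c..d} = x ` {c..d}"
        using eq by (auto intro!: image_cong)
      then have e1: "adjacent_colours L \<nu> x {a..b} {c..d} = adjacent_colours L \<nu> y {a..b} {c..d}"
        by (simp add: adjacent_colours_def)
      have e2: "(\<forall>i\<in>{a..b}. x i \<noteq> 0) = (\<forall>i\<in>{a..b}. y i \<noteq> 0)"
        "(\<forall>i\<in>{b<..<c}. x i = 0) = (\<forall>i\<in>{b<..<c}. y i = 0)"
        "(\<forall>i\<in>{c..d}. x i \<noteq> 0) = (\<forall>i\<in>{c..d}. y i \<noteq> 0)"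
        using eq True by (intro ball_cong; simp)+
      show ?thesis by (simp only: e1 e2)
    next
      case False
      then have "\<not> a \<le> b \<or> \<not> b + 1 < c \<or> \<not> c \<le> d" by blast
      then show ?thesis by (elim disjE) (simp_all only: simp_thms)
    qed
  qed simp
  have "coloured_subshift L \<nu> \<tau> = {x. locally_admissible L \<nu> \<tau> x}"
    by (rule set_eqI) (simp only: coloured_subshift_iff[OF assms] mem_Collect_eq)
  also have "closed \<dots>"
    unfolding locally_admissible_def
    by (intro closed_Collect_conj closed_Collect_all c1 c2 c3)
  finally show ?thesis .
qed

text \<open>A closed subset of a product of finite alphabets, which is compact by Tychonoff's
  theorem.\<close>

lemma compact_coloured_subshift:
  assumes "0 < \<tau>"
  shows "compact (coloured_subshift L \<nu> \<tau>)"
proof -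
  have "compactin (product_topology (\<lambda>i::int. euclidean) UNIV) (PiE UNIV (\<lambda>i. {..L * \<nu>}))"
    by (rule compactin_PiE[THEN iffD2]) (simp add: finite_imp_compact)
  then have c: "compact (PiE (UNIV :: int set) (\<lambda>i. {..L * \<nu>}))"
    by (simp add: euclidean_product_topology)
  have "coloured_subshift L \<nu> \<tau> \<subseteq> PiE UNIV (\<lambda>i. {..L * \<nu>})"
    using assms by (auto simp: coloured_subshift_iff locally_admissibleD(1))
  then show ?thesis
    using compact_Int_closed[OF c closed_coloured_subshift[OF assms, of L \<nu>]]
    by (simp only: Int_absorb1)
qed

subsection \<open>Counting words\<close>

definition word :: "(int \<Rightarrow> 'a) \<Rightarrow> int \<Rightarrow> nat \<Rightarrow> 'a list" where
  "word x p n = map (\<lambda>k. x (p + int k)) [0..<n]"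

lemma length_word [simp]: "length (word x p n) = n"
  by (simp add: word_def)

lemma nth_word [simp]: "k < n \<Longrightarrow> word x p n ! k = x (p + int k)"
  by (simp add: word_def)

lemma word_0 [simp]: "word x p 0 = []"
  by (simp add: word_def)

lemma word_add: "word x p (m + n) = word x p m @ word x (p + int m) n"
  by (rule nth_equalityI) (auto simp: nth_append)

lemma word_eq_iff: "word x p n = word y q n \<longleftrightarrow> (\<forall>k<n. x (p + int k) = y (q + int k))"
  by (simp add: list_eq_iff_nth_eq)

lemma set_word: "set (word x p n) = x ` {p..p + int n - 1}"
proof -
  have "(\<lambda>k. p + int k) ` {0..<n} = {p..p + int n - 1}"
  proof (intro equalityI subsetI)
    fix i assume "i \<in> {p..p + int n - 1}"
    then have "i = p + int (nat (i - p))" "nat (i - p) \<in> {0..<n}" by auto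
    then show "i \<in> (\<lambda>k. p + int k) ` {0..<n}" by blast
  qed auto
  then have "x ` {p..p + int n - 1} = (\<lambda>k. x (p + int k)) ` {0..<n}" by (metis image_image)
  then show ?thesis by (simp add: word_def)
qed

text \<open>What a window can show after a block of colour \<open>j\<close> of which
  \<open>a\<close> symbols are visible. The lengths \<open>a\<close> and \<open>length u\<close> are
  those seen in the window, where a block may be cut off by either end. The intersection with
  \<open>{1..L}\<close> also removes the value \<open>j - 1 = 0\<close> for the first
  colour.\<close>

inductive gap_tail :: "nat \<Rightarrow> nat \<Rightarrow> real \<Rightarrow> nat \<Rightarrow> nat \<Rightarrow> nat list \<Rightarrow> bool" for L \<nu> \<tau> where
  zeros: "gap_tail L \<nu> \<tau> a j (replicate n 0)"
| block: "1 \<le> length u \<Longrightarrow> j' \<in> {1..L} \<inter> {j - 1, j + 1} \<Longrightarrow> \<tau> * real (a + length u) \<le> real g \<Longrightarrow>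
    set u \<subseteq> colour_symbols \<nu> j' \<Longrightarrow> gap_tail L \<nu> \<tau> (length u) j' w \<Longrightarrow>
    gap_tail L \<nu> \<tau> a j (replicate g 0 @ u @ w)"

text \<open>Parses off the leading zeros and the first run of coloured symbols. A zero after the run
  is only guaranteed if the run ends before the window does.\<close>

lemma word_first_block:
  fixes x :: "int \<Rightarrow> nat"
  obtains (zeros) "word x q n = replicate n 0"
  | (block) g b where "1 \<le> b" "g + b \<le> n" "\<And>i. i \<in> {q..<q + int g} \<Longrightarrow> x i = 0"
      "\<And>i. i \<in> {q + int g..q + int g + int b - 1} \<Longrightarrow> x i \<noteq> 0"
      "g + b < n \<Longrightarrow> x (q + int g + int b) = 0"
      "word x q n = replicate g 0 @ word x (q + int g) b @ word x (q + int g + int b) (n - g - b)"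
proof (cases "\<exists>k<n. x (q + int k) \<noteq> 0")
  case False
  then have "word x q n = replicate n 0" by (simp add: list_eq_iff_nth_eq)
  then show ?thesis by (rule zeros)
next
  case True
  define g where "g = (LEAST k. k < n \<and> x (q + int k) \<noteq> 0)"
  have g: "g < n" "x (q + int g) \<noteq> 0"
    using LeastI_ex[OF True] by (simp_all add: g_def)
  have g_min: "x (q + int k) = 0" if "k < g" for k
    using not_less_Least[OF that[unfolded g_def]] that g(1) by auto
  \<comment> \<open>The end of the window also stops the run, so that this least number always
    exists.\<close>
  define b where "b = (LEAST k. n \<le> g + k \<or> x (q + int g + int k) = 0)"
  have ex: "\<exists>k. n \<le> g + k \<or> x (q + int g + int k) = 0" by (intro exI[of _ n]) simp
  have b: "n \<le> g + b \<or> x (q + int g + int b) = 0"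
    unfolding b_def by (rule LeastI_ex[OF ex])
  have b_min: "g + k < n \<and> x (q + int g + int k) \<noteq> 0" if "k < b" for k
    using not_less_Least[OF that[unfolded b_def]] by simp
  have "b \<noteq> 0" using b g by (intro notI) simp
  then have b1: "1 \<le> b" by simp
  have "g + (b - 1) < n" using b_min[of "b - 1"] b1 by simp
  then have gb: "g + b \<le> n" using b1 by simp
  have zero: "x i = 0" if "i \<in> {q..<q + int g}" for i
    using g_min[of "nat (i - q)"] that by (simp add: nat_less_iff)
  have nz: "x i \<noteq> 0" if "i \<in> {q + int g..q + int g + int b - 1}" for i
    using b_min[of "nat (i - q - int g)"] that by (simp add: nat_less_iff)
  have "word x q n = word x q (g + (b + (n - g - b)))" using gb by simp
  also have "\<dots> = word x q g @ word x (q + int g) b @ word x (q + int g + int b) (n - g - b)"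
    by (simp only: word_add)
  also have "word x q g = replicate g 0" using g_min by (simp add: list_eq_iff_nth_eq)
  finally show ?thesis
    using b1 gb zero nz b by (intro block[of b g]) auto
qed

text \<open>Strong induction on the length, stripping off one gap and one block per round. Of the
  past only the last \<open>a\<close> symbols and their colour matter.\<close>

lemma gap_tail_word:
  assumes adm: "locally_admissible L \<nu> \<tau> x"
  shows "1 \<le> a \<Longrightarrow> j \<in> {1..L} \<Longrightarrow> (\<And>i. i \<in> {q - int a..q - 1} \<Longrightarrow> x i \<noteq> 0) \<Longrightarrow>
    x (q - 1) \<in> colour_symbols \<nu> j \<Longrightarrow> (0 < n \<Longrightarrow> x q = 0) \<Longrightarrow> gap_tail L \<nu> \<tau> a j (word x q n)"
proof (induction n arbitrary: a j q rule: less_induct)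
  case (less n)
  show ?case
  proof (cases rule: word_first_block[of x q n])
    case zeros
    then show ?thesis by (simp add: gap_tail.zeros)
  next
    case (block g b)
    \<comment> \<open>A gap of at least one zero is what the local condition asks for with
      \<open>b + 1 < c\<close>; it exists because the preceding run is followed by a zero.\<close>
    have "g \<noteq> 0"
    proof
      assume "g = 0"
      then have "x q \<noteq> 0" using block(4)[of q] block(1) by simp
      moreover have "0 < n" using block(1,2) by simp
      ultimately show False using less.prems(5) by simp
    qed
    let ?c = "q + int g"
    have "adjacent_colours L \<nu> x {q - int a..q - 1} {?c..?c + int b - 1} \<and>
      \<tau> * real_of_int ((q - 1 - (q - int a) + 1) + (?c + int b - 1 - ?c + 1)) \<le>
        real_of_int (?c - (q - 1) - 1)"
      using less.prems(1) \<open>g \<noteq> 0\<close> block(1)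
      by (intro locally_admissibleD(3)[OF adm]) (use less.prems(3) block(3,4) in auto)
    then have adj: "adjacent_colours L \<nu> x {q - int a..q - 1} {?c..?c + int b - 1}"
      and gap: "\<tau> * real (a + b) \<le> real g" by simp_all
    from adj obtain j1 j' where j: "j1 \<in> {1..L}" "j' \<in> {1..L}"
      "x ` {q - int a..q - 1} \<subseteq> colour_symbols \<nu> j1" "x ` {?c..?c + int b - 1} \<subseteq> colour_symbols \<nu> j'"
      "j' = j1 + 1 \<or> j1 = j' + 1"
      unfolding adjacent_colours_def by blast
    have "x (q - 1) \<in> x ` {q - int a..q - 1}" using less.prems(1) by (intro imageI) simp
    then have "x (q - 1) \<in> colour_symbols \<nu> j1" using j(3) by blast
    then have "j1 = j"
      using less.prems(2,4) j(1) by (intro colour_symbols_disjoint[of "x (q - 1)" \<nu>]) auto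
    then have j'_adj: "j' \<in> {1..L} \<inter> {j - 1, j + 1}" using j(2,5) by auto
    have last: "x (?c + int b - 1) \<in> colour_symbols \<nu> j'"
      using j(4) block(1) by (simp add: image_subset_iff)
    have "gap_tail L \<nu> \<tau> b j' (word x (?c + int b) (n - g - b))"
      by (rule less.IH) (use block j(2) last in auto)
    then have "gap_tail L \<nu> \<tau> a j
        (replicate g 0 @ word x ?c b @ word x (?c + int b) (n - g - b))"
      using block(1) j'_adj gap j(4) by (intro gap_tail.block) (simp_all add: set_word)
    then show ?thesis by (simp only: block(6))
  qed
qed

definition gap_tails :: "nat \<Rightarrow> nat \<Rightarrow> real \<Rightarrow> nat \<Rightarrow> nat \<Rightarrow> nat \<Rightarrow> nat list set" where
  "gap_tails L \<nu> \<tau> a j n = {w. gap_tail L \<nu> \<tau> a j w \<and> length w = n}"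

definition prepend_block :: "nat \<Rightarrow> nat \<Rightarrow> nat \<Rightarrow> nat \<Rightarrow> nat list set \<Rightarrow> nat list set" where
  "prepend_block \<nu> g b j T =
     (\<lambda>(u, w). replicate g 0 @ u @ w) ` ({u. set u \<subseteq> colour_symbols \<nu> j \<and> length u = b} \<times> T)"

lemma prepend_blockI:
  assumes "set u \<subseteq> colour_symbols \<nu> j" "length u = b" "w \<in> T"
  shows "replicate g 0 @ u @ w \<in> prepend_block \<nu> g b j T"
  unfolding prepend_block_def using assms by (intro image_eqI[of _ _ "(u, w)"]) auto

lemma card_prepend_block:
  assumes "finite T" "1 \<le> j"
  shows "finite (prepend_block \<nu> g b j T)" "card (prepend_block \<nu> g b j T) \<le> \<nu> ^ b * card T"
proof -
  have fin: "finite {u. set u \<subseteq> colour_symbols \<nu> j \<and> length u = b}"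
    by (rule finite_lists_length_eq) simp
  then show "finite (prepend_block \<nu> g b j T)"
    using assms by (simp add: prepend_block_def)
  have "card (prepend_block \<nu> g b j T) \<le>
      card ({u. set u \<subseteq> colour_symbols \<nu> j \<and> length u = b} \<times> T)"
    unfolding prepend_block_def using fin assms by (intro card_image_le) simp
  also have "\<dots> = \<nu> ^ b * card T"
    by (simp add: card_cartesian_product card_lists_length_eq card_colour_symbols[OF assms(2)])
  finally show "card (prepend_block \<nu> g b j T) \<le> \<nu> ^ b * card T" .
qed

text \<open>A renewal recursion: apart from the all-zero word, a tail is a gap, a block and a
  shorter tail whose parameters are the length and colour of that block.\<close>

lemma gap_tails_subset:
  "gap_tails L \<nu> \<tau> a j n \<subseteq> {replicate n 0} \<union>
    (\<Union>b\<in>{1..n}. \<Union>g\<in>{g. g \<le> n \<and> g + b \<le> n \<and> \<tau> * real (a + b) \<le> real g}. \<Union>j'\<in>{1..L} \<inter> {j - 1, j + 1}.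
       prepend_block \<nu> g b j' (gap_tails L \<nu> \<tau> b j' (n - g - b)))"
proof
  fix w assume "w \<in> gap_tails L \<nu> \<tau> a j n"
  then have w: "gap_tail L \<nu> \<tau> a j w" "length w = n" by (auto simp: gap_tails_def)
  from w(1) show "w \<in> {replicate n 0} \<union>
    (\<Union>b\<in>{1..n}. \<Union>g\<in>{g. g \<le> n \<and> g + b \<le> n \<and> \<tau> * real (a + b) \<le> real g}. \<Union>j'\<in>{1..L} \<inter> {j - 1, j + 1}.
       prepend_block \<nu> g b j' (gap_tails L \<nu> \<tau> b j' (n - g - b)))"
  proof cases
    case (zeros m)
    then show ?thesis using w(2) by simp
  next
    case (block u j' g v)
    have "w \<in> prepend_block \<nu> g (length u) j' (gap_tails L \<nu> \<tau> (length u) j' (n - g - length u))"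
      unfolding block(1) using block w(2) by (intro prepend_blockI) (auto simp: gap_tails_def)
    moreover have "length u \<in> {1..n}" "g \<le> n \<and> g + length u \<le> n \<and> \<tau> * real (a + length u) \<le> real g"
      using block w(2) by auto
    ultimately show ?thesis using block(3) by blast
  qed
qed

lemma sum_power_le_geometric:
  fixes q :: real
  assumes "0 \<le> q" "q < 1"
  shows "(\<Sum>g=m..n. q ^ g) \<le> q ^ m / (1 - q)"
proof -
  have "(q ^ m - q ^ Suc n) / (1 - q) \<le> q ^ m / (1 - q)"
    using assms by (intro divide_right_mono) auto
  then show ?thesis using assms by (simp add: sum_gp)
qed

text \<open>This is the only place where the bound on \<open>\<tau>\<close> enters, as \<open>\<nu>\<^sup>\<tau> \<ge> 5\<close>.\<close>

lemma sum_gap_weights_le: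
  assumes "2 \<le> \<nu>" "\<tau> \<ge> ln 5 / ln (real \<nu>)"
  shows "(\<Sum>g\<in>{g. g \<le> n \<and> \<tau> * real s \<le> real g}. (1 / real \<nu>) ^ g) \<le> 2 * (1 / 5) ^ s"
proof -
  define g0 where "g0 = nat \<lceil>\<tau> * real s\<rceil>"
  have ln\<nu>: "0 < ln (real \<nu>)" using assms(1) by simp
  have ln5: "ln 5 \<le> \<tau> * ln (real \<nu>)" using assms(2) ln\<nu> by (simp add: field_simps)
  have "0 < \<tau>" using assms(2) ln\<nu> by (smt (verit) divide_pos_pos ln_gt_zero)
  have "5 ^ s = exp (real s * ln 5)" by (simp add: exp_of_nat_mult)
  also have "\<dots> \<le> exp (real s * (\<tau> * ln (real \<nu>)))"
    using ln5 by (simp add: mult_left_mono)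
  also have "\<dots> = exp ((\<tau> * real s) * ln (real \<nu>))" by (simp add: ac_simps)
  also have "\<dots> \<le> exp (real g0 * ln (real \<nu>))"
    unfolding g0_def exp_le_cancel_iff using ln\<nu> by (intro mult_right_mono) linarith+
  also have "\<dots> = real \<nu> ^ g0" using assms(1) by (simp add: exp_of_nat_mult)
  finally have "5 ^ s \<le> real \<nu> ^ g0" .
  then have g0: "(1 / real \<nu>) ^ g0 \<le> (1 / 5) ^ s"
    using assms(1) by (simp add: power_one_over frac_le)
  have "(\<Sum>g\<in>{g. g \<le> n \<and> \<tau> * real s \<le> real g}. (1 / real \<nu>) ^ g) \<le> (\<Sum>g=g0..n. (1 / real \<nu>) ^ g)"
  proof (rule sum_mono2)
    show "{g. g \<le> n \<and> \<tau> * real s \<le> real g} \<subseteq> {g0..n}"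
      by (auto simp: g0_def ceiling_le_iff)
  qed auto
  also have "\<dots> \<le> (1 / real \<nu>) ^ g0 / (1 - 1 / real \<nu>)"
    using assms(1) by (intro sum_power_le_geometric) auto
  \<comment> \<open>As \<nu> is at least 2, the denominator is at least 1/2; this is the factor 2 in
    the claim.\<close>
  also have "\<dots> \<le> (1 / real \<nu>) ^ g0 / (1 / 2)"
    using assms(1) by (intro divide_left_mono) (auto simp: field_simps)
  also have "\<dots> \<le> 2 * (1 / 5) ^ s" using g0 by simp
  finally show ?thesis .
qed

text \<open>The bound reproduces itself: the all-zero word contributes 1 and all choices of a first
  block together at most 2/5 of \<open>\<nu> ^ n\<close>. It has to be uniform in \<open>a\<close>
  and \<open>j\<close>, since the recursion changes both.\<close>

lemma card_gap_tails:
  assumes "2 \<le> \<nu>" "\<tau> \<ge> ln 5 / ln (real \<nu>)"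
  shows "1 \<le> a \<Longrightarrow> finite (gap_tails L \<nu> \<tau> a j n) \<and> card (gap_tails L \<nu> \<tau> a j n) \<le> 2 * \<nu> ^ n"
proof (induction n arbitrary: a j rule: less_induct)
  case (less n)
  define G where "G b = {g. g \<le> n \<and> g + b \<le> n \<and> \<tau> * real (a + b) \<le> real g}" for b
  define J where "J = {1..L} \<inter> {j - 1, j + 1}"
  define E where "E b g j' = prepend_block \<nu> g b j' (gap_tails L \<nu> \<tau> b j' (n - g - b))" for b g j'
  have finG: "finite (G b)" for b
    by (rule finite_subset[of _ "{..n}"]) (auto simp: G_def)
  have finJ: "finite J" by (simp add: J_def)
  have cardJ: "card J \<le> 2"
  proof -
    have "card J \<le> card {j - 1, j + 1}" unfolding J_def by (rule card_mono) auto
    also have "\<dots> \<le> 2" by (simp add: card_insert_if)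
    finally show ?thesis .
  qed
  \<comment> \<open>The \<open>\<nu> ^ b\<close> fillings of the block compensate exactly for the
    shortening of the tail by \<open>b\<close>, so only the gap length \<open>g\<close> remains in
    the bound.\<close>
  have E: "finite (E b g j')" "real (card (E b g j')) \<le> 2 * real \<nu> ^ n * (1 / real \<nu>) ^ g"
    if "b \<in> {1..n}" "g \<in> G b" "j' \<in> J" for b g j'
  proof -
    have gb: "g + b \<le> n" "1 \<le> b" using that by (auto simp: G_def)
    then have IH: "finite (gap_tails L \<nu> \<tau> b j' (n - g - b))"
      "card (gap_tails L \<nu> \<tau> b j' (n - g - b)) \<le> 2 * \<nu> ^ (n - g - b)"
      using less.IH[of "n - g - b" b j'] by auto
    have j': "1 \<le> j'" using that by (simp add: J_def)
    show "finite (E b g j')" unfolding E_def by (rule card_prepend_block[OF IH(1) j'])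
    have "card (E b g j') \<le> \<nu> ^ b * card (gap_tails L \<nu> \<tau> b j' (n - g - b))"
      unfolding E_def by (rule card_prepend_block[OF IH(1) j'])
    also have "\<dots> \<le> \<nu> ^ b * (2 * \<nu> ^ (n - g - b))" using IH(2) by (rule mult_left_mono) simp
    also have "\<dots> = 2 * \<nu> ^ (n - g)"
      using gb by (simp add: mult.left_commute flip: power_add)
    finally have "real (card (E b g j')) \<le> real (2 * \<nu> ^ (n - g))" by (simp only: of_nat_le_iff)
    also have "\<dots> = 2 * real \<nu> ^ (n - g)" by simp
    also have "\<dots> = 2 * real \<nu> ^ n * (1 / real \<nu>) ^ g"
      using assms(1) gb by (subst power_diff) (auto simp: power_one_over)
    finally show "real (card (E b g j')) \<le> 2 * real \<nu> ^ n * (1 / real \<nu>) ^ g" .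
  qed
  have sub: "gap_tails L \<nu> \<tau> a j n \<subseteq> {replicate n 0} \<union> (\<Union>b\<in>{1..n}. \<Union>g\<in>G b. \<Union>j'\<in>J. E b g j')"
    using gap_tails_subset[of L \<nu> \<tau> a j n] by (simp only: G_def J_def E_def)
  have fin: "finite ({replicate n 0} \<union> (\<Union>b\<in>{1..n}. \<Union>g\<in>G b. \<Union>j'\<in>J. E b g j'))"
    using finG finJ E(1) by auto
  have "card (gap_tails L \<nu> \<tau> a j n) \<le> card ({replicate n 0} \<union> (\<Union>b\<in>{1..n}. \<Union>g\<in>G b. \<Union>j'\<in>J. E b g j'))"
    by (rule card_mono[OF fin sub])
  also have "\<dots> \<le> card {replicate n (0::nat)} + card (\<Union>b\<in>{1..n}. \<Union>g\<in>G b. \<Union>j'\<in>J. E b g j')"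
    by (rule card_Un_le)
  also have "\<dots> \<le> 1 + (\<Sum>b\<in>{1..n}. \<Sum>g\<in>G b. \<Sum>j'\<in>J. card (E b g j'))"
    by (auto intro!: order_trans[OF card_UN_le] sum_mono finG finJ)
  finally have "real (card (gap_tails L \<nu> \<tau> a j n)) \<le>
      1 + (\<Sum>b\<in>{1..n}. \<Sum>g\<in>G b. \<Sum>j'\<in>J. real (card (E b g j')))"
    by (simp flip: of_nat_sum of_nat_add of_nat_Suc)
  also have "(\<Sum>b\<in>{1..n}. \<Sum>g\<in>G b. \<Sum>j'\<in>J. real (card (E b g j'))) \<le>
      (\<Sum>b\<in>{1..n}. \<Sum>g\<in>G b. \<Sum>j'\<in>J. 2 * real \<nu> ^ n * (1 / real \<nu>) ^ g)"
    by (intro sum_mono E(2))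
  \<comment> \<open>The 4 is the constant 2 of the induction hypothesis times at most two colours
    for the next block.\<close>
  also have "\<dots> \<le> (\<Sum>b\<in>{1..n}. \<Sum>g\<in>G b. 4 * real \<nu> ^ n * (1 / real \<nu>) ^ g)"
  proof (intro sum_mono)
    fix b g
    have "real (card J) * (2 * real \<nu> ^ n * (1 / real \<nu>) ^ g) \<le> 2 * (2 * real \<nu> ^ n * (1 / real \<nu>) ^ g)"
      using cardJ by (intro mult_right_mono) auto
    then show "(\<Sum>j'\<in>J. 2 * real \<nu> ^ n * (1 / real \<nu>) ^ g) \<le> 4 * real \<nu> ^ n * (1 / real \<nu>) ^ g"
      by simp
  qed
  also have "\<dots> = (\<Sum>b\<in>{1..n}. 4 * real \<nu> ^ n * (\<Sum>g\<in>G b. (1 / real \<nu>) ^ g))"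
    by (simp only: sum_distrib_left)
  also have "\<dots> \<le> (\<Sum>b\<in>{1..n}. 4 * real \<nu> ^ n * (2 * (1 / 5) ^ (a + b)))"
  proof (intro sum_mono mult_left_mono)
    fix b
    have "(\<Sum>g\<in>G b. (1 / real \<nu>) ^ g) \<le>
        (\<Sum>g\<in>{g. g \<le> n \<and> \<tau> * real (a + b) \<le> real g}. (1 / real \<nu>) ^ g)"
      by (rule sum_mono2) (auto simp: G_def)
    also have "\<dots> \<le> 2 * (1 / 5) ^ (a + b)" by (rule sum_gap_weights_le[OF assms])
    finally show "(\<Sum>g\<in>G b. (1 / real \<nu>) ^ g) \<le> 2 * (1 / 5) ^ (a + b)" .
  qed simp
  also have "\<dots> = 8 * real \<nu> ^ n * (1 / 5) ^ a * (\<Sum>b=1..n. (1 / 5) ^ b)"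
    by (simp add: sum_distrib_left power_add algebra_simps)
  \<comment> \<open>Here \<open>1 \<le> a\<close> enters, giving one factor 1/5; the geometric
    series over \<open>b\<close> gives 1/4, so that the total is 8/20 = 2/5.\<close>
  also have "\<dots> \<le> 8 * real \<nu> ^ n * (1 / 5) ^ 1 * ((1 / 5) ^ 1 / (1 - 1 / 5))"
  proof (intro mult_mono)
    show "(1 / 5 :: real) ^ a \<le> (1 / 5) ^ 1" using less.prems by (intro power_decreasing) auto
    show "(\<Sum>b=1..n. (1 / 5 :: real) ^ b) \<le> (1 / 5) ^ 1 / (1 - 1 / 5)"
      by (rule sum_power_le_geometric) auto
  qed (auto intro: sum_nonneg)
  finally have "real (card (gap_tails L \<nu> \<tau> a j n)) \<le> 1 + 2 / 5 * real \<nu> ^ n" by simp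
  moreover have "1 \<le> real \<nu> ^ n" using assms(1) by (intro one_le_power) simp
  ultimately have "real (card (gap_tails L \<nu> \<tau> a j n)) \<le> 2 * real \<nu> ^ n" by linarith
  then have "card (gap_tails L \<nu> \<tau> a j n) \<le> 2 * \<nu> ^ n"
    by (metis of_nat_le_iff of_nat_mult of_nat_numeral of_nat_power)
  then show ?case using finite_subset[OF sub fin] by blast
qed

section \<open>Growth of the number of words\<close>

definition subshift_words :: "nat \<Rightarrow> nat \<Rightarrow> real \<Rightarrow> int \<Rightarrow> nat \<Rightarrow> nat list set" where
  "subshift_words L \<nu> \<tau> p n = (\<lambda>x. word x p n) ` coloured_subshift L \<nu> \<tau>"

text \<open>The first visible block has no visible predecessor, so its colour and the zeros before
  it are free; everything after it is a \<open>gap_tail\<close>.\<close>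

lemma subshift_words_subset:
  assumes "0 < \<tau>"
  shows "subshift_words L \<nu> \<tau> p n \<subseteq> {replicate n 0} \<union>
    (\<Union>(b, g)\<in>{(b, g). 1 \<le> b \<and> g + b \<le> n}. \<Union>j\<in>{1..L}.
       prepend_block \<nu> g b j (gap_tails L \<nu> \<tau> b j (n - g - b)))"
proof
  fix w assume "w \<in> subshift_words L \<nu> \<tau> p n"
  then obtain x where adm: "locally_admissible L \<nu> \<tau> x" and w: "w = word x p n"
    using coloured_subshift_iff[OF assms] by (auto simp: subshift_words_def)
  show "w \<in> {replicate n 0} \<union>
    (\<Union>(b, g)\<in>{(b, g). 1 \<le> b \<and> g + b \<le> n}. \<Union>j\<in>{1..L}.
       prepend_block \<nu> g b j (gap_tails L \<nu> \<tau> b j (n - g - b)))"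
  proof (cases rule: word_first_block[of x p n])
    case zeros
    then show ?thesis using w by simp
  next
    case (block g b)
    let ?c = "p + int g"
    have "monochromatic_on L \<nu> x {?c..?c + int b - 1}"
      by (rule locally_admissibleD(2)[OF adm]) (use block in auto)
    then obtain j where j: "j \<in> {1..L}" "x ` {?c..?c + int b - 1} \<subseteq> colour_symbols \<nu> j"
      unfolding monochromatic_on_def by blast
    have last: "x (?c + int b - 1) \<in> colour_symbols \<nu> j"
      using j(2) block(1) by (simp add: image_subset_iff)
    have "gap_tail L \<nu> \<tau> b j (word x (?c + int b) (n - g - b))"
      by (rule gap_tail_word[OF adm]) (use block j(1) last in auto)
    then have "w \<in> prepend_block \<nu> g b j (gap_tails L \<nu> \<tau> b j (n - g - b))"
      unfolding w block(6) using j(2) by (intro prepend_blockI) (simp_all add: set_word gap_tails_def)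
    then show ?thesis using block(1,2) j(1) by blast
  qed
qed

text \<open>There are at most (n+1)^2 choices of the pair \<open>(b, g)\<close> and \<open>L\<close>
  of the colour, and each leaves at most \<open>2 * \<nu> ^ n\<close> words.\<close>

lemma card_subshift_words:
  assumes "2 \<le> \<nu>" "\<tau> \<ge> ln 5 / ln (real \<nu>)" "0 < \<tau>"
  shows "finite (subshift_words L \<nu> \<tau> p n)"
    and "card (subshift_words L \<nu> \<tau> p n) \<le> (1 + 2 * L * (n + 1)\<^sup>2) * \<nu> ^ n"
proof -
  define I where "I = {(b, g). 1 \<le> b \<and> g + b \<le> n}"
  define E where "E b g j = prepend_block \<nu> g b j (gap_tails L \<nu> \<tau> b j (n - g - b))" for b g j
  have I_sub: "I \<subseteq> {..n} \<times> {..n}" by (auto simp: I_def)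
  then have finI: "finite I" by (rule finite_subset) simp
  have "card I \<le> card ({..n} \<times> {..n})" using I_sub by (intro card_mono) auto
  then have cardI: "card I \<le> (n + 1)\<^sup>2" by (simp add: power2_eq_square)
  have E: "finite (E b g j)" "card (E b g j) \<le> 2 * \<nu> ^ n"
    if "(b, g) \<in> I" "j \<in> {1..L}" for b g j
  proof -
    have bg: "1 \<le> b" "g + b \<le> n" using that by (auto simp: I_def)
    note T = card_gap_tails[OF assms(1,2) bg(1), of L j "n - g - b"]
    have j: "1 \<le> j" using that by simp
    show "finite (E b g j)" unfolding E_def using T j by (intro card_prepend_block) auto
    have "card (E b g j) \<le> \<nu> ^ b * card (gap_tails L \<nu> \<tau> b j (n - g - b))"
      unfolding E_def using T j by (intro card_prepend_block) auto
    also have "\<dots> \<le> \<nu> ^ b * (2 * \<nu> ^ (n - g - b))" using T by (intro mult_left_mono) auto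
    also have "\<dots> = 2 * \<nu> ^ (n - g)" using bg by (simp add: mult.left_commute flip: power_add)
    also have "\<dots> \<le> 2 * \<nu> ^ n" using assms(1) by (simp add: power_increasing)
    finally show "card (E b g j) \<le> 2 * \<nu> ^ n" .
  qed
  have sub: "subshift_words L \<nu> \<tau> p n \<subseteq> {replicate n 0} \<union> (\<Union>(b, g)\<in>I. \<Union>j\<in>{1..L}. E b g j)"
    using subshift_words_subset[OF assms(3), of L \<nu> p n] by (simp only: I_def E_def)
  have fin: "finite ({replicate n 0} \<union> (\<Union>(b, g)\<in>I. \<Union>j\<in>{1..L}. E b g j))"
    using finI E(1) by auto
  show "finite (subshift_words L \<nu> \<tau> p n)" by (rule finite_subset[OF sub fin])
  have "card (subshift_words L \<nu> \<tau> p n) \<le> card ({replicate n 0} \<union> (\<Union>(b, g)\<in>I. \<Union>j\<in>{1..L}. E b g j))"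
    by (rule card_mono[OF fin sub])
  also have "\<dots> \<le> card {replicate n (0::nat)} + card (\<Union>(b, g)\<in>I. \<Union>j\<in>{1..L}. E b g j)"
    by (rule card_Un_le)
  also have "card (\<Union>(b, g)\<in>I. \<Union>j\<in>{1..L}. E b g j) \<le> (\<Sum>bg\<in>I. card (case bg of (b, g) \<Rightarrow> \<Union>j\<in>{1..L}. E b g j))"
    by (rule card_UN_le[OF finI])
  also have "\<dots> \<le> (\<Sum>bg\<in>I. L * (2 * \<nu> ^ n))"
  proof (rule sum_mono)
    fix bg assume bg: "bg \<in> I"
    obtain b g where bg_eq: "bg = (b, g)" by (cases bg)
    have "card (\<Union>j\<in>{1..L}. E b g j) \<le> (\<Sum>j\<in>{1..L}. card (E b g j))" by (rule card_UN_le) simp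
    also have "\<dots> \<le> (\<Sum>j\<in>{1..L}. 2 * \<nu> ^ n)" using bg bg_eq by (intro sum_mono E(2)) auto
    finally show "card (case bg of (b, g) \<Rightarrow> \<Union>j\<in>{1..L}. E b g j) \<le> L * (2 * \<nu> ^ n)"
      by (simp add: bg_eq)
  qed
  also have "\<dots> \<le> (n + 1)\<^sup>2 * (L * (2 * \<nu> ^ n))"
    using cardI by (simp add: mult_right_mono del: One_nat_def)
  finally have "card (subshift_words L \<nu> \<tau> p n) \<le> 1 + (n + 1)\<^sup>2 * (L * (2 * \<nu> ^ n))" by simp
  also have "\<dots> \<le> \<nu> ^ n + (n + 1)\<^sup>2 * (L * (2 * \<nu> ^ n))" using assms(1) by simp
  also have "\<dots> = (1 + 2 * L * (n + 1)\<^sup>2) * \<nu> ^ n" by (simp only: algebra_simps)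
  finally show "card (subshift_words L \<nu> \<tau> p n) \<le> (1 + 2 * L * (n + 1)\<^sup>2) * \<nu> ^ n" .
qed

text \<open>The additive constant \<open>r\<close> absorbs the finite overlap of windows, which does not affect the rate.\<close>

lemma subshift_words_growth:
  assumes "2 \<le> \<nu>" "\<tau> \<ge> ln 5 / ln (real \<nu>)" "0 < \<tau>"
  shows "\<exists>f. f \<longlonglongrightarrow> ln (real \<nu>) \<and>
    (\<forall>n p. ln (real (card (subshift_words L \<nu> \<tau> p (n + r)))) / real n \<le> f n)"
proof (intro exI conjI allI)
  let ?f = "\<lambda>n. (ln (1 + 2 * real L * (real n + real r + 1)\<^sup>2) + (real n + real r) * ln (real \<nu>)) / real n"
  show "?f \<longlonglongrightarrow> ln (real \<nu>)"
  proof (cases "L = 0")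
    case True
    then show ?thesis by simp real_asymp
  next
    case False
    define l where "l = real L"
    have "0 < l" using False by (simp add: l_def)
    then show ?thesis unfolding l_def[symmetric] by real_asymp
  qed
  show "ln (real (card (subshift_words L \<nu> \<tau> p (n + r)))) / real n \<le> ?f n" for n p
  proof (rule divide_right_mono)
    let ?c = "card (subshift_words L \<nu> \<tau> p (n + r))"
    have pos: "0 < (1 + 2 * real L * (real n + real r + 1)\<^sup>2)"
      by (smt (verit) mult_nonneg_nonneg of_nat_0_le_iff zero_le_power2)
    have "real ?c \<le> real ((1 + 2 * L * (n + r + 1)\<^sup>2) * \<nu> ^ (n + r))"
      using card_subshift_words(2)[OF assms, of L p "n + r"] by (simp only: of_nat_le_iff)
    also have "\<dots> = (1 + 2 * real L * (real n + real r + 1)\<^sup>2) * real \<nu> ^ (n + r)"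
      by (simp only: of_nat_mult of_nat_power of_nat_add of_nat_1 of_nat_numeral)
    finally have c: "real ?c \<le> (1 + 2 * real L * (real n + real r + 1)\<^sup>2) * real \<nu> ^ (n + r)" .
    have rhs: "ln ((1 + 2 * real L * (real n + real r + 1)\<^sup>2) * real \<nu> ^ (n + r)) =
        ln (1 + 2 * real L * (real n + real r + 1)\<^sup>2) + (real n + real r) * ln (real \<nu>)"
      using pos assms(1) by (subst ln_mult) (auto simp: ln_realpow)
    \<comment> \<open>Nonnegativity settles the case of no words at all, where
      \<open>ln 0 = 0\<close>.\<close>
    have "0 \<le> ln (1 + 2 * real L * (real n + real r + 1)\<^sup>2) + (real n + real r) * ln (real \<nu>)"
      using assms(1) by (intro add_nonneg_nonneg mult_nonneg_nonneg) (auto intro!: ln_ge_zero)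
    moreover have "ln (real ?c) \<le> ln ((1 + 2 * real L * (real n + real r + 1)\<^sup>2) * real \<nu> ^ (n + r))"
      if "?c \<noteq> 0" using c that by (intro ln_mono) auto
    ultimately show "ln (real ?c) \<le>
        ln (1 + 2 * real L * (real n + real r + 1)\<^sup>2) + (real n + real r) * ln (real \<nu>)"
      unfolding rhs by (cases "?c = 0") auto
  qed simp
qed

subsection \<open>Topological entropy\<close>

definition agree_on :: "'i set \<Rightarrow> ('i \<Rightarrow> 'a) \<Rightarrow> ('i \<Rightarrow> 'a) \<Rightarrow> bool" where
  "agree_on J x y \<longleftrightarrow> (\<forall>i\<in>J. x i = y i)"

abbreviation window :: "nat \<Rightarrow> int set" where
  "window m \<equiv> {- int m..int m}"

lemma agree_onI: "(\<And>i. i \<in> J \<Longrightarrow> x i = y i) \<Longrightarrow> agree_on J x y"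
  by (simp add: agree_on_def)

lemma agree_on_subset: "agree_on J x y \<Longrightarrow> I \<subseteq> J \<Longrightarrow> agree_on I x y"
  by (auto simp: agree_on_def)

lemma agree_on_trans: "agree_on J x y \<Longrightarrow> agree_on J y z \<Longrightarrow> agree_on J x z"
  by (simp add: agree_on_def)

lemma agree_on_sym: "agree_on J x y \<Longrightarrow> agree_on J y x"
  by (simp add: agree_on_def)

lemma window_mono: "m \<le> n \<Longrightarrow> window m \<subseteq> window n"
  by auto

lemma finite_int_subset_window:
  assumes "finite J"
  shows "\<exists>m. J \<subseteq> window m"
proof -
  obtain m where "\<forall>i\<in>J. nat \<bar>i\<bar> \<le> m"
    using finite_nat_set_iff_bounded_le[of "(\<lambda>i. nat \<bar>i\<bar>) ` J"] assms by auto
  then have "J \<subseteq> window m" by fastforce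
  then show ?thesis ..
qed

lemma open_agree_on:
  fixes x :: "'i \<Rightarrow> 'a::discrete_topology"
  assumes "finite J"
  shows "open {y. agree_on J x y}"
  by (rule open_finite_window[OF assms]) (simp add: agree_on_def)

text \<open>A basic open set of the product topology restricts finitely many coordinates, and these
  fit into a symmetric window.\<close>

lemma open_imp_agree_on_subset:
  fixes U :: "(int \<Rightarrow> 'a::discrete_topology) set"
  assumes "open U" "x \<in> U"
  shows "\<exists>m. {y. agree_on (window m) x y} \<subseteq> U"
proof -
  have "openin (product_topology (\<lambda>i. euclidean) UNIV) U"
    using assms(1) by (simp add: euclidean_product_topology)
  from product_topology_open_contains_basis[OF this assms(2)]
  obtain X where X: "x \<in> PiE UNIV X" "finite {i. X i \<noteq> topspace euclidean}" "PiE UNIV X \<subseteq> U"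
    by (elim exE conjE) (rule that)
  obtain m where m: "{i. X i \<noteq> UNIV} \<subseteq> window m"
    using finite_int_subset_window[OF X(2)] by auto
  have "{y. agree_on (window m) x y} \<subseteq> PiE UNIV X"
  proof
    fix y assume y: "y \<in> {y. agree_on (window m) x y}"
    have "y i \<in> X i" for i
    proof (cases "i \<in> window m")
      case True
      then have "x i = y i" using y by (simp add: agree_on_def)
      then show ?thesis using PiE_mem[OF X(1), of i] by simp
    next
      case False
      then show ?thesis using m by blast
    qed
    then show "y \<in> PiE UNIV X" by auto
  qed
  then show ?thesis using X(3) by blast
qed

text \<open>The analogue of a Lebesgue number, with a window size in place of a radius. Agreement on
  a window is transitive, so the largest window of a finite subcover already works.\<close>

lemma open_cover_window:
  fixes S :: "(int \<Rightarrow> 'a::discrete_topology) set"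
  assumes "compact S" "open_cover S U"
  shows "\<exists>m. \<forall>x\<in>S. \<exists>A\<in>U. {y\<in>S. agree_on (window m) x y} \<subseteq> A"
proof -
  have "\<exists>m A. A \<in> U \<and> {y\<in>S. agree_on (window m) x y} \<subseteq> A" if "x \<in> S" for x
  proof -
    have "x \<in> \<Union>U" using assms(2) that by (simp add: open_cover_def)
    then obtain A where A: "A \<in> U" "x \<in> A" by (rule UnionE)
    then obtain V where V: "open V" "A = S \<inter> V"
      using assms(2) unfolding open_cover_def openin_open by blast
    then obtain m where "{y. agree_on (window m) x y} \<subseteq> V"
      using open_imp_agree_on_subset[of V x] A by auto
    then show ?thesis using A(1) V(2) by blast
  qed
  then obtain m A where mA: "\<And>x. x \<in> S \<Longrightarrow> A x \<in> U"
    "\<And>x. x \<in> S \<Longrightarrow> {y\<in>S. agree_on (window (m x)) x y} \<subseteq> A x"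
    by metis
  have cov: "S \<subseteq> (\<Union>x\<in>S. {y. agree_on (window (m x)) x y})"
  proof
    fix x assume "x \<in> S"
    moreover have "agree_on (window (m x)) x x" by (simp add: agree_on_def)
    ultimately show "x \<in> (\<Union>x\<in>S. {y. agree_on (window (m x)) x y})" by blast
  qed
  obtain F where F: "F \<subseteq> S" "finite F" "S \<subseteq> (\<Union>x\<in>F. {y. agree_on (window (m x)) x y})"
    by (rule compactE_image[OF assms(1) open_agree_on[OF finite_atLeastAtMost_int] cov])
  \<comment> \<open>Inserting 0 keeps \<open>Max\<close> meaningful when \<open>F\<close> is
    empty.\<close>
  define M where "M = Max (insert 0 (m ` F))"
  have M: "m x \<le> M" if "x \<in> F" for x
    unfolding M_def using F(2) that by (intro Max_ge) auto
  have "\<exists>A\<in>U. {z\<in>S. agree_on (window M) y z} \<subseteq> A" if y: "y \<in> S" for y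
  proof -
    obtain x where x: "x \<in> F" "agree_on (window (m x)) x y" using F(3) y by blast
    have "agree_on (window (m x)) x z" if "agree_on (window M) y z" for z
      using x agree_on_trans agree_on_subset[OF that window_mono[OF M[OF x(1)]]] by blast
    then have "{z\<in>S. agree_on (window M) y z} \<subseteq> A x" using mA(2)[of x] F(1) x(1) by blast
    then show ?thesis using mA(1)[of x] F(1) x(1) by blast
  qed
  then show ?thesis by blast
qed

text \<open>The word occupies the positions from \<open>- int m\<close> to
  \<open>int n + int m\<close> and hence contains every translate of the window by some
  \<open>i < n\<close>.\<close>

lemma agree_on_shift_window:
  assumes "word x (- int m) (n + (2 * m + 1)) = word y (- int m) (n + (2 * m + 1))" "i < n"
  shows "agree_on (window m) ((left_shift ^^ i) x) ((left_shift ^^ i) y)"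
proof (rule agree_onI)
  fix k assume k: "k \<in> window m"
  define l where "l = nat (k + int i + int m)"
  have l: "int l = k + int i + int m" using k by (simp add: l_def)
  have "l < n + (2 * m + 1)" using l k assms(2) by auto
  then have "x (- int m + int l) = y (- int m + int l)" using assms(1) by (simp add: word_eq_iff)
  moreover have "- int m + int l = k + int i" using l by simp
  ultimately show "(left_shift ^^ i) x k = (left_shift ^^ i) y k"
    by (simp add: left_shift_funpow)
qed

lemma min_subcover_card_le:
  assumes "V \<subseteq> U" "finite V" "\<Union>V = S"
  shows "min_subcover_card S U \<le> card V"
  unfolding min_subcover_card_def by (rule Least_le) (use assms in blast)

lemma min_subcover_card_attained:
  assumes "V \<subseteq> U" "finite V" "\<Union>V = S"
  obtains W where "W \<subseteq> U" "finite W" "card W = min_subcover_card S U" "\<Union>W = S"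
proof -
  have "\<exists>k. \<exists>V\<subseteq>U. finite V \<and> card V = k \<and> \<Union>V = S" using assms by blast
  from LeastI_ex[OF this] show ?thesis using that unfolding min_subcover_card_def by blast
qed

text \<open>For each word one representative is chosen; all sequences with this word follow its
  itinerary through the cover, so one member of the join per word suffices.\<close>

lemma min_subcover_card_le_words:
  fixes S :: "(int \<Rightarrow> 'a) set"
  assumes shift: "\<And>x i. x \<in> S \<Longrightarrow> (left_shift ^^ i) x \<in> S"
    and fin: "finite ((\<lambda>x. word x (- int m) (n + (2 * m + 1))) ` S)"
    and cover: "\<forall>x\<in>S. \<exists>A\<in>U. {y\<in>S. agree_on (window m) x y} \<subseteq> A"
  shows "min_subcover_card S (dyn_join S left_shift n U) \<le>
    card ((\<lambda>x. word x (- int m) (n + (2 * m + 1))) ` S)"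
proof -
  define w where "w x = word x (- int m) (n + (2 * m + 1))" for x :: "int \<Rightarrow> 'a"
  obtain A where A: "\<And>x. x \<in> S \<Longrightarrow> A x \<in> U"
    "\<And>x. x \<in> S \<Longrightarrow> {y\<in>S. agree_on (window m) x y} \<subseteq> A x"
    using cover by metis
  define cell where "cell x = {y\<in>S. \<forall>i<n. (left_shift ^^ i) y \<in> A ((left_shift ^^ i) x)}" for x
  define r where "r v = (SOME x. x \<in> S \<and> w x = v)" for v
  have r: "r (w x) \<in> S" "w (r (w x)) = w x" if "x \<in> S" for x
    using someI[of "\<lambda>z. z \<in> S \<and> w z = w x" x] that by (auto simp: r_def)
  define V where "V = (\<lambda>v. cell (r v)) ` w ` S"
  have "V \<subseteq> dyn_join S left_shift n U"
  proof
    fix B assume "B \<in> V"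
    then obtain x where x: "x \<in> S" "B = cell (r (w x))" by (auto simp: V_def)
    have "A ((left_shift ^^ i) (r (w x))) \<in> U" for i
      by (rule A(1)[OF shift[OF r(1)[OF x(1)]]])
    then show "B \<in> dyn_join S left_shift n U"
      unfolding dyn_join_def x(2) cell_def
      by (intro CollectI exI[of _ "\<lambda>i. A ((left_shift ^^ i) (r (w x)))"]) simp
  qed
  moreover have "finite V" using fin by (simp add: V_def w_def)
  moreover have "\<Union>V = S"
  proof (intro equalityI subsetI)
    fix x assume x: "x \<in> S"
    have "(left_shift ^^ i) x \<in> A ((left_shift ^^ i) (r (w x)))" if "i < n" for i
    proof -
      have "agree_on (window m) ((left_shift ^^ i) (r (w x))) ((left_shift ^^ i) x)"
        by (rule agree_on_shift_window[OF _ that]) (use r(2)[OF x] in \<open>simp add: w_def\<close>)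
      then show ?thesis using A(2)[OF shift[OF r(1)[OF x]]] shift[OF x] by blast
    qed
    then have "x \<in> cell (r (w x))" using x by (simp add: cell_def)
    then show "x \<in> \<Union>V" using x by (auto simp: V_def)
  qed (auto simp: V_def cell_def)
  ultimately have "min_subcover_card S (dyn_join S left_shift n U) \<le> card V"
    by (rule min_subcover_card_le)
  also have "\<dots> \<le> card (w ` S)" unfolding V_def using fin by (intro card_image_le) (simp add: w_def)
  finally show ?thesis by (simp add: w_def)
qed

lemma limsup_le_of_tendsto:
  fixes a f :: "nat \<Rightarrow> real"
  assumes "\<And>n. a n \<le> f n" "f \<longlonglongrightarrow> l"
  shows "limsup (\<lambda>n. ereal (a n)) \<le> ereal l"
proof -
  have "limsup (\<lambda>n. ereal (a n)) \<le> limsup (\<lambda>n. ereal (f n))"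
    using assms(1) by (intro Limsup_mono always_eventually) simp
  also have "\<dots> = ereal l"
    using assms(2) by (intro lim_imp_Limsup) auto
  finally show ?thesis .
qed

lemma topological_entropy_le:
  assumes "2 \<le> \<nu>" "\<tau> \<ge> ln 5 / ln (real \<nu>)" "0 < \<tau>"
  shows "topological_entropy (coloured_subshift L \<nu> \<tau>) left_shift \<le> ereal (ln (real \<nu>))"
  unfolding topological_entropy_def
proof (rule SUP_least)
  let ?S = "coloured_subshift L \<nu> \<tau>"
  fix U assume "U \<in> {U. open_cover ?S U}"
  then obtain m where m: "\<forall>x\<in>?S. \<exists>A\<in>U. {y\<in>?S. agree_on (window m) x y} \<subseteq> A"
    using open_cover_window[OF compact_coloured_subshift[OF assms(3)]] by blast
  obtain f where f: "f \<longlonglongrightarrow> ln (real \<nu>)"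
    "\<And>n p. ln (real (card (subshift_words L \<nu> \<tau> p (n + (2 * m + 1))))) / real n \<le> f n"
    using subshift_words_growth[OF assms, of L "2 * m + 1"] by blast
  have "ln (real (min_subcover_card ?S (dyn_join ?S left_shift n U))) / real n \<le> f n" for n
  proof -
    let ?c = "min_subcover_card ?S (dyn_join ?S left_shift n U)"
    let ?W = "subshift_words L \<nu> \<tau> (- int m) (n + (2 * m + 1))"
    have c: "?c \<le> card ?W"
      unfolding subshift_words_def
      by (rule min_subcover_card_le_words[OF left_shift_funpow_in_coloured_subshift[OF assms(3)] _ m])
        (use card_subshift_words(1)[OF assms] in \<open>simp_all add: subshift_words_def\<close>)
    have "ln (real ?c) \<le> ln (real (card ?W))"
    \<comment> \<open>The case 0 relies on \<open>ln 0 = 0\<close>, which is below the logarithm of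
      any natural number.\<close>
    proof (cases "?c = 0")
      case True
      then show ?thesis by (cases "card ?W = 0") simp_all
    next
      case False
      then show ?thesis using c by (intro ln_mono) auto
    qed
    then have "ln (real ?c) / real n \<le> ln (real (card ?W)) / real n" by (rule divide_right_mono) simp
    then show ?thesis using f(2)[of "- int m" n] by linarith
  qed
  then show "cover_entropy ?S left_shift U \<le> ereal (ln (real \<nu>))"
    unfolding cover_entropy_def using f(1) by (rule limsup_le_of_tendsto)
qed

subsection \<open>Shannon entropy of simple functions\<close>

definition shannon_entropy :: "'a measure \<Rightarrow> ('a \<Rightarrow> 'b) \<Rightarrow> real" where
  "shannon_entropy M X =
     - (\<Sum>v\<in>X ` space M. measure M (X -` {v} \<inter> space M) * ln (measure M (X -` {v} \<inter> space M)))"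

text \<open>Base \<open>exp 1\<close> turns the library's entropy into natural logarithms; the
  cardinality bound, data processing and the chain rule become available through it.\<close>

lemma shannon_entropy_eq_entropy:
  assumes "prob_space M" "simple_function M X"
  shows "shannon_entropy M X = prob_space.entropy M (exp 1) (count_space (X ` space M)) X"
proof -
  interpret information_space M "exp 1"
    using assms(1) by (simp add: information_space_def information_space_axioms_def)
  have "simple_distributed M X (\<lambda>v. measure M (X -` {v} \<inter> space M))"
    by (rule simple_distributedI[OF assms(2) measure_nonneg refl])
  from entropy_simple_distributed[OF this] show ?thesis
    by (simp add: shannon_entropy_def log_def)
qed

lemma shannon_entropy_le_card:
  assumes "prob_space M" "simple_function M X"
  shows "shannon_entropy M X \<le> ln (real (card (X ` space M)))"
proof -
  interpret information_space M "exp 1"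
    using assms(1) by (simp add: information_space_def information_space_axioms_def)
  have "simple_distributed M X (\<lambda>v. measure M (X -` {v} \<inter> space M))"
    by (rule simple_distributedI[OF assms(2) measure_nonneg refl])
  from entropy_le_card[OF this] show ?thesis
    by (simp add: shannon_entropy_eq_entropy[OF assms] log_def)
qed

lemma shannon_entropy_cong:
  assumes "\<And>x. x \<in> space M \<Longrightarrow> X x = Y x"
  shows "shannon_entropy M X = shannon_entropy M Y"
proof -
  have "X ` space M = Y ` space M" using assms by (intro image_cong) auto
  moreover have "X -` {v} \<inter> space M = Y -` {v} \<inter> space M" for v using assms by auto
  ultimately show ?thesis by (simp add: shannon_entropy_def)
qed

text \<open>\<open>Y\<close> factors through \<open>X\<close> by evaluating it on a chosen
  representative of each fibre; the rest is data processing.\<close>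

lemma shannon_entropy_determined_le:
  assumes "prob_space M" "simple_function M X"
    and det: "\<And>x y. x \<in> space M \<Longrightarrow> y \<in> space M \<Longrightarrow> X x = X y \<Longrightarrow> Y x = Y y"
  shows "shannon_entropy M Y \<le> shannon_entropy M X"
proof -
  interpret information_space M "exp 1"
    using assms(1) by (simp add: information_space_def information_space_axioms_def)
  define f where "f v = Y (SOME x. x \<in> space M \<and> X x = v)" for v
  have f: "Y x = (f \<circ> X) x" if "x \<in> space M" for x
  proof -
    have "(SOME z. z \<in> space M \<and> X z = X x) \<in> space M \<and> X (SOME z. z \<in> space M \<and> X z = X x) = X x"
      by (rule someI[of _ x]) (use that in simp)
    then show ?thesis using det[OF that] by (simp add: f_def)
  qed
  have "shannon_entropy M Y = shannon_entropy M (f \<circ> X)" using f by (rule shannon_entropy_cong)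
  also have "\<dots> \<le> shannon_entropy M X"
    using entropy_data_processing[OF assms(2), of f]
    by (simp add: shannon_entropy_eq_entropy[OF assms(1,2)]
        shannon_entropy_eq_entropy[OF assms(1) simple_function_compose[OF assms(2)]])
  finally show ?thesis .
qed

text \<open>\<open>Z\<close> is a function of the pair; the chain rule and the fact that
  conditioning does not increase entropy bound the entropy of the pair.\<close>

lemma shannon_entropy_pair_le:
  assumes "prob_space M" "simple_function M X" "simple_function M Y"
    and det: "\<And>x y. x \<in> space M \<Longrightarrow> y \<in> space M \<Longrightarrow> X x = X y \<Longrightarrow> Y x = Y y \<Longrightarrow> Z x = Z y"
  shows "shannon_entropy M Z \<le> shannon_entropy M X + shannon_entropy M Y"
proof -
  interpret information_space M "exp 1"
    using assms(1) by (simp add: information_space_def information_space_axioms_def)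
  have XY: "simple_function M (\<lambda>x. (X x, Y x))" using assms(2,3) by (rule simple_function_Pair)
  have "shannon_entropy M Z \<le> shannon_entropy M (\<lambda>x. (X x, Y x))"
    by (rule shannon_entropy_determined_le[OF assms(1) XY]) (use det in blast)
  also have "\<dots> \<le> shannon_entropy M X + shannon_entropy M Y"
    using entropy_chain_rule[OF assms(2,3)] conditional_entropy_less_eq_entropy[OF assms(3,2)]
    by (simp add: shannon_entropy_eq_entropy[OF assms(1)] XY assms(2,3))
  finally show ?thesis .
qed

text \<open>Both follow from \<open>- ln q \<le> 1 / q - 1\<close>, used at \<open>p\<close> and at
  \<open>sqrt p\<close>. The first is sharp for probabilities near 1, the second tends to 0 with
  \<open>p\<close>.\<close>

lemma neg_mult_ln_le:
  fixes p :: real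
  assumes "0 \<le> p"
  shows "- (p * ln p) \<le> 1 - p" "- (p * ln p) \<le> 2 * sqrt p"
proof -
  have *: "- ln q \<le> 1 / q - 1" if "0 < q" for q :: real
    using ln_le_minus_one[of "1 / q"] that by (simp add: ln_div)
  show "- (p * ln p) \<le> 1 - p"
  proof (cases "p = 0")
    case False
    then have "p * - ln p \<le> p * (1 / p - 1)" using assms by (intro mult_left_mono *) auto
    then show ?thesis using False by (simp add: algebra_simps)
  qed simp
  show "- (p * ln p) \<le> 2 * sqrt p"
  proof (cases "p = 0")
    case False
    then have p: "0 < p" using assms by simp
    have "- ln (sqrt p) \<le> 1 / sqrt p" using *[of "sqrt p"] p by simp
    then have "- ln p \<le> 2 / sqrt p" using p by (simp add: ln_sqrt)
    then have "p * - ln p \<le> p * (2 / sqrt p)" using p by (intro mult_left_mono) auto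
    also have "\<dots> = 2 * sqrt p" using p by (simp add: field_simps flip: power2_eq_square)
    finally show ?thesis by simp
  qed simp
qed

text \<open>The dominant value \<open>z\<close> has probability at least \<open>1 - d\<close> and
  contributes at most \<open>d\<close>; every other value has probability at most \<open>d\<close>
  and contributes at most \<open>2 * sqrt d\<close>.\<close>

lemma shannon_entropy_almost_constant_le:
  assumes "prob_space M" "simple_function M X" "finite V"
    and range: "\<And>x. x \<in> space M \<Longrightarrow> X x \<in> insert z V"
    and small: "measure M {x \<in> space M. X x \<noteq> z} \<le> d"
  shows "shannon_entropy M X \<le> d + real (card V) * (2 * sqrt d)"
proof -
  interpret prob_space M by fact
  define p where "p v = measure M (X -` {v} \<inter> space M)" for v
  have meas: "X -` {v} \<inter> space M \<in> sets M" for v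
    using assms(2) by (rule simple_functionD(2))
  have X_ne: "{x \<in> space M. X x \<noteq> z} = space M - (X -` {z} \<inter> space M)" by auto
  have d: "0 \<le> d" by (rule order_trans[OF measure_nonneg small])
  have pz: "1 - p z \<le> d"
    using small meas[of z] unfolding X_ne p_def by (simp add: prob_compl)
  have pv: "p v \<le> d" if "v \<noteq> z" for v
  proof -
    have "p v \<le> measure M {x \<in> space M. X x \<noteq> z}"
      unfolding p_def X_ne using that meas by (intro finite_measure_mono) auto
    then show ?thesis using small by linarith
  qed
  have h_nonneg: "0 \<le> - (p v * ln (p v))" for v
  proof (cases "p v = 0")
    case False
    then have "0 < p v" "p v \<le> 1" by (simp_all add: p_def zero_less_measure_iff)
    then have "ln (p v) \<le> 0" by simp
    then show ?thesis using \<open>0 < p v\<close> by (simp add: mult_nonneg_nonpos)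
  qed simp
  have "shannon_entropy M X = (\<Sum>v\<in>X ` space M. - (p v * ln (p v)))"
    by (simp add: shannon_entropy_def p_def sum_negf)
  \<comment> \<open>All terms are nonnegative, so the sum may be extended to values that are not
    attained.\<close>
  also have "\<dots> \<le> (\<Sum>v\<in>insert z (V - {z}). - (p v * ln (p v)))"
  proof (rule sum_mono2)
    show "X ` space M \<subseteq> insert z (V - {z})" using range by blast
  qed (use assms(3) h_nonneg in simp_all)
  also have "\<dots> = - (p z * ln (p z)) + (\<Sum>v\<in>V - {z}. - (p v * ln (p v)))"
    using assms(3) by (subst sum.insert) auto
  also have "\<dots> \<le> d + (\<Sum>v\<in>V - {z}. 2 * sqrt d)"
  proof (intro add_mono sum_mono)
    show "- (p z * ln (p z)) \<le> d"
      using neg_mult_ln_le(1)[of "p z"] pz by (simp add: p_def)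
    show "- (p v * ln (p v)) \<le> 2 * sqrt d" if "v \<in> V - {z}" for v
    proof -
      have "- (p v * ln (p v)) \<le> 2 * sqrt (p v)" by (rule neg_mult_ln_le) (simp add: p_def)
      also have "\<dots> \<le> 2 * sqrt d" using pv[of v] that by simp
      finally show ?thesis .
    qed
  qed
  also have "\<dots> \<le> d + real (card V) * (2 * sqrt d)"
  proof -
    have "card (V - {z}) \<le> card V" using assms(3) by (intro card_mono) auto
    then show ?thesis using d by (simp add: mult_right_mono)
  qed
  finally show ?thesis .
qed

subsection \<open>Entropy of a partition\<close>

definition partition_cell :: "'a set set \<Rightarrow> 'a \<Rightarrow> 'a set" where
  "partition_cell P x = (THE A. A \<in> P \<and> x \<in> A)"

lemma partition_cell_eq:
  assumes "partition_on S P" "A \<in> P" "x \<in> A"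
  shows "partition_cell P x = A"
  unfolding partition_cell_def
proof (rule the_equality)
  show "A \<in> P \<and> x \<in> A" using assms by simp
  show "B = A" if "B \<in> P \<and> x \<in> B" for B
    using assms that unfolding partition_on_def disjoint_def by blast
qed

lemma partition_cell_in:
  assumes "partition_on S P" "x \<in> S"
  shows "partition_cell P x \<in> P" "x \<in> partition_cell P x"
proof -
  have "x \<in> \<Union>P" using assms by (simp add: partition_on_def)
  then obtain A where "A \<in> P" "x \<in> A" by (rule UnionE)
  then show "partition_cell P x \<in> P" "x \<in> partition_cell P x"
    using partition_cell_eq[OF assms(1)] by simp_all
qed

text \<open>The refined partition as a random variable, which makes the inequalities for Shannon
  entropy applicable to it.\<close>

definition join_cell :: "'a set \<Rightarrow> ('a \<Rightarrow> 'a) \<Rightarrow> nat \<Rightarrow> 'a set set \<Rightarrow> 'a \<Rightarrow> 'a set" where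
  "join_cell S T n P x = {y \<in> S. \<forall>i<n. (T ^^ i) y \<in> partition_cell P ((T ^^ i) x)}"

lemma funpow_in_space:
  assumes "T \<in> measurable M M" "x \<in> space M"
  shows "(T ^^ i) x \<in> space M"
  by (induction i) (use assms measurable_space[OF assms(1)] in auto)

lemma measurable_funpow:
  assumes "T \<in> measurable M M"
  shows "T ^^ i \<in> measurable M M"
proof (induction i)
  case (Suc i)
  show ?case unfolding funpow.simps by (rule measurable_comp[OF Suc.IH assms])
qed (simp add: id_def)

lemma measure_funpow_vimage:
  assumes "invariant_measure M T" "A \<in> sets M"
  shows "measure M ((T ^^ i) -` A \<inter> space M) = measure M A"
proof (induction i)
  case 0
  then show ?case using sets.sets_into_space[OF assms(2)] by (simp add: Int_absorb2)
next
  case (Suc i)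
  have T: "T \<in> measurable M M" and inv: "distr M M T = M"
    using assms(1) by (auto simp: invariant_measure_def)
  let ?B = "(T ^^ i) -` A \<inter> space M"
  have B: "?B \<in> sets M" using measurable_funpow[OF T] assms(2) by (rule measurable_sets)
  have "(T ^^ Suc i) -` A \<inter> space M = T -` ?B \<inter> space M"
    using measurable_space[OF T] by (auto simp: funpow_swap1)
  then have "measure M ((T ^^ Suc i) -` A \<inter> space M) = measure (distr M M T) ?B"
    by (simp add: measure_distr[OF T B])
  then show ?case by (simp only: inv Suc.IH)
qed

lemma join_cell_eq_iff:
  assumes "partition_on (space M) P" "T \<in> measurable M M" "x \<in> space M" "y \<in> space M"
  shows "y \<in> join_cell (space M) T n P x \<longleftrightarrow>
    (\<forall>i<n. partition_cell P ((T ^^ i) y) = partition_cell P ((T ^^ i) x))"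
    and "join_cell (space M) T n P y = join_cell (space M) T n P x \<longleftrightarrow>
      y \<in> join_cell (space M) T n P x"
proof -
  have *: "(T ^^ i) y \<in> partition_cell P ((T ^^ i) x) \<longleftrightarrow>
      partition_cell P ((T ^^ i) y) = partition_cell P ((T ^^ i) x)"
    if "x \<in> space M" "y \<in> space M" for i x y
    using partition_cell_in[OF assms(1) funpow_in_space[OF assms(2) that(1), of i]]
      partition_cell_in[OF assms(1) funpow_in_space[OF assms(2) that(2), of i]]
      partition_cell_eq[OF assms(1)] by metis
  have iff: "y \<in> join_cell (space M) T n P x \<longleftrightarrow>
      (\<forall>i<n. partition_cell P ((T ^^ i) y) = partition_cell P ((T ^^ i) x))"
    if "x \<in> space M" "y \<in> space M" for x y
    using *[OF that] that(2) by (simp add: join_cell_def)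
  show "y \<in> join_cell (space M) T n P x \<longleftrightarrow>
      (\<forall>i<n. partition_cell P ((T ^^ i) y) = partition_cell P ((T ^^ i) x))"
    by (rule iff[OF assms(3,4)])
  show "join_cell (space M) T n P y = join_cell (space M) T n P x \<longleftrightarrow>
      y \<in> join_cell (space M) T n P x"
  proof
    assume "join_cell (space M) T n P y = join_cell (space M) T n P x"
    moreover have "y \<in> join_cell (space M) T n P y" using iff[OF assms(4,4)] by simp
    ultimately show "y \<in> join_cell (space M) T n P x" by simp
  next
    assume "y \<in> join_cell (space M) T n P x"
    then show "join_cell (space M) T n P y = join_cell (space M) T n P x"
      using iff[OF assms(3,4)] by (simp add: join_cell_def)
  qed
qed

lemma dyn_join_vs_join_cell:
  assumes "partition_on (space M) P" "T \<in> measurable M M"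
  shows "join_cell (space M) T n P ` space M \<subseteq> dyn_join (space M) T n P"
    and "dyn_join (space M) T n P \<subseteq> insert {} (join_cell (space M) T n P ` space M)"
proof -
  show "join_cell (space M) T n P ` space M \<subseteq> dyn_join (space M) T n P"
  proof
    fix B assume "B \<in> join_cell (space M) T n P ` space M"
    then obtain x where x: "x \<in> space M" "B = join_cell (space M) T n P x" by blast
    have "partition_cell P ((T ^^ i) x) \<in> P" for i
      by (rule partition_cell_in(1)[OF assms(1) funpow_in_space[OF assms(2) x(1)]])
    then show "B \<in> dyn_join (space M) T n P"
      unfolding dyn_join_def x(2) join_cell_def
      by (intro CollectI exI[of _ "\<lambda>i. partition_cell P ((T ^^ i) x)"]) simp
  qed
  show "dyn_join (space M) T n P \<subseteq> insert {} (join_cell (space M) T n P ` space M)"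
  proof
    fix B assume "B \<in> dyn_join (space M) T n P"
    then obtain c where c: "B = {x \<in> space M. \<forall>i<n. (T ^^ i) x \<in> c i}" "\<And>i. i < n \<Longrightarrow> c i \<in> P"
      unfolding dyn_join_def by blast
    show "B \<in> insert {} (join_cell (space M) T n P ` space M)"
    proof (cases "B = {}")
      case False
      then obtain x where x: "x \<in> B" by blast
      have "partition_cell P ((T ^^ i) x) = c i" if "i < n" for i
        using x c(1) that by (intro partition_cell_eq[OF assms(1) c(2)]) auto
      then have "B = join_cell (space M) T n P x" by (simp add: join_cell_def c(1))
      then show ?thesis using x c(1) by blast
    qed simp
  qed
qed

lemma finite_dyn_join:
  assumes "finite P"
  shows "finite (dyn_join S T n P)"
proof -
  have "dyn_join S T n P \<subseteq> (\<lambda>c. {x \<in> S. \<forall>i<n. (T ^^ i) x \<in> c i}) ` (PiE {..<n} (\<lambda>_. P))"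
  proof
    fix B assume "B \<in> dyn_join S T n P"
    then obtain c where c: "B = {x \<in> S. \<forall>i<n. (T ^^ i) x \<in> c i}" "\<forall>i<n. c i \<in> P"
      unfolding dyn_join_def by blast
    show "B \<in> (\<lambda>c. {x \<in> S. \<forall>i<n. (T ^^ i) x \<in> c i}) ` (PiE {..<n} (\<lambda>_. P))"
      by (rule image_eqI[of _ _ "restrict c {..<n}"]) (use c in auto)
  qed
  then show ?thesis by (rule finite_subset) (simp add: finite_PiE assms)
qed

text \<open>The fibre of \<open>join_cell\<close> over a cell is the cell itself, and the possible
  extra member \<open>{}\<close> of the join contributes 0.\<close>

lemma static_entropy_dyn_join:
  assumes "finite P" "P \<subseteq> sets M" "partition_on (space M) P" "T \<in> measurable M M"
  shows "static_entropy M (dyn_join (space M) T n P) =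
    shannon_entropy M (join_cell (space M) T n P)"
proof -
  let ?J = "join_cell (space M) T n P"
  have vim: "?J -` {B} \<inter> space M = B" if B: "B \<in> ?J ` space M" for B
  proof -
    obtain x where x: "x \<in> space M" "B = ?J x" using B by blast
    have "B \<subseteq> space M" by (auto simp: x(2) join_cell_def)
    then show ?thesis using join_cell_eq_iff(2)[OF assms(3,4) x(1), of _ n] by (auto simp: x(2))
  qed
  have "(\<Sum>A\<in>dyn_join (space M) T n P. measure M A * ln (measure M A)) =
      (\<Sum>A\<in>?J ` space M. measure M A * ln (measure M A))"
    using finite_dyn_join[OF assms(1), of "space M" T n] dyn_join_vs_join_cell[OF assms(3,4), of n]
    by (intro sum.mono_neutral_right) auto
  also have "\<dots> = (\<Sum>B\<in>?J ` space M. measure M (?J -` {B} \<inter> space M) *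
      ln (measure M (?J -` {B} \<inter> space M)))"
    by (rule sum.cong) (simp_all add: vim)
  finally show ?thesis by (simp add: static_entropy_def shannon_entropy_def)
qed

subsection \<open>Approximation by sets depending on finitely many coordinates\<close>

definition window_set :: "(int \<Rightarrow> 'a) set \<Rightarrow> nat \<Rightarrow> (int \<Rightarrow> 'a) set \<Rightarrow> bool" where
  "window_set S m B \<longleftrightarrow>
     B \<subseteq> S \<and> (\<forall>x\<in>S. \<forall>y\<in>S. agree_on (window m) x y \<longrightarrow> x \<in> B \<longrightarrow> y \<in> B)"

lemma window_setD: "window_set S m B \<Longrightarrow> x \<in> B \<Longrightarrow> y \<in> S \<Longrightarrow> agree_on (window m) x y \<Longrightarrow> y \<in> B"
  by (auto simp: window_set_def)

lemma window_set_mono: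
  assumes "window_set S m B" "m \<le> n"
  shows "window_set S n B"
  using assms agree_on_subset[OF _ window_mono[OF assms(2)]] unfolding window_set_def by blast

lemma window_set_compl:
  assumes "window_set S m B"
  shows "window_set S m (S - B)"
  using assms agree_on_sym unfolding window_set_def by blast

lemma window_set_UN:
  assumes "\<And>k. k \<in> K \<Longrightarrow> window_set S m (B k)"
  shows "window_set S m (\<Union>k\<in>K. B k)"
  using assms unfolding window_set_def by blast

text \<open>Borel sets and product \<sigma>-algebra coincide for countably many discrete factors;
  the explicit generators permit induction over Borel sets.\<close>

lemma sets_borel_seq_eq:
  "sets (borel :: (int \<Rightarrow> nat) measure) = sigma_sets UNIV {{f. f i \<in> A} | i A. A \<in> sets borel}"
proof -
  have "sets (borel :: (int \<Rightarrow> nat) measure) = sets (PiM UNIV (\<lambda>_. borel))"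
    by (rule sets_PiM_equal_borel[symmetric])
  also have "\<dots> = sigma_sets UNIV {{f. f i \<in> A} | i A. A \<in> sets borel}"
    by (simp add: sets_PiM_single)
  finally show ?thesis .
qed

text \<open>The sets that can be approximated with arbitrary precision contain the generators and
  form a \<sigma>-algebra: complementation within \<open>S\<close> preserves the symmetric
  difference, and a countable union is first truncated to a finite one.\<close>

lemma window_approximation:
  fixes M :: "(int \<Rightarrow> nat) measure"
  assumes "prob_space M" and sets: "sets M = sets (restrict_space borel S)" and "A \<in> sets M" "0 < e"
  shows "\<exists>m B. B \<in> sets M \<and> window_set S m B \<and> measure M ((A - B) \<union> (B - A)) < e"
proof -
  interpret prob_space M by fact
  have S_eq: "space M = S"
    using sets_eq_imp_space_eq[OF sets] by (simp add: space_restrict_space)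
  have inS: "S \<inter> C \<in> sets M" if "C \<in> sets borel" for C
    unfolding sets sets_restrict_space using that by (rule imageI)
  have "\<forall>e>0. \<exists>m B. B \<in> sets M \<and> window_set S m B \<and>
      measure M ((S \<inter> C - B) \<union> (B - S \<inter> C)) < e"
    if "C \<in> sigma_sets UNIV {{f. f i \<in> A} | i A. A \<in> sets (borel :: nat measure)}"
    for C :: "(int \<Rightarrow> nat) set"
    using that
  proof (induction rule: sigma_sets.induct)
    case (Basic C)
    then obtain i and D :: "nat set" where C: "C = {f. f i \<in> D}" "D \<in> sets borel" by blast
    have "C \<in> sets borel" unfolding sets_borel_seq_eq using Basic by (rule sigma_sets.Basic)
    then have "S \<inter> C \<in> sets M" by (rule inS)
    moreover have "window_set S (nat \<bar>i\<bar>) (S \<inter> C)"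
      unfolding window_set_def
    proof (intro conjI ballI impI)
      fix x y assume "y \<in> S" "agree_on (window (nat \<bar>i\<bar>)) x y" "x \<in> S \<inter> C"
      moreover have "i \<in> window (nat \<bar>i\<bar>)" by auto
      ultimately have "x i = y i" unfolding agree_on_def by blast
      then show "y \<in> S \<inter> C" using \<open>y \<in> S\<close> \<open>x \<in> S \<inter> C\<close> by (simp add: C(1))
    qed simp
    moreover have "measure M ((S \<inter> C - S \<inter> C) \<union> (S \<inter> C - S \<inter> C)) = 0" by simp
    ultimately show ?case by (intro allI impI exI conjI) (assumption | simp only:)+
  next
    case Empty
    have "window_set S 0 {}" by (simp add: window_set_def)
    then show ?case by (intro allI impI exI[of _ 0] exI[of _ "{}"]) simp
  next
    case (Compl C)
    show ?case
    proof (intro allI impI)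
      fix e :: real assume "0 < e"
      with Compl.IH obtain m B where B: "B \<in> sets M" "window_set S m B"
        "measure M ((S \<inter> C - B) \<union> (B - S \<inter> C)) < e" by blast
      have "B \<subseteq> S" using B(2) by (simp add: window_set_def)
      then have "(S \<inter> (UNIV - C) - (S - B)) \<union> ((S - B) - S \<inter> (UNIV - C)) =
        (S \<inter> C - B) \<union> (B - S \<inter> C)" by blast
      moreover have "S - B \<in> sets M" using B(1) sets.compl_sets[of B M] by (simp add: S_eq)
      ultimately show "\<exists>m B. B \<in> sets M \<and> window_set S m B \<and>
          measure M ((S \<inter> (UNIV - C) - B) \<union> (B - S \<inter> (UNIV - C))) < e"
        using B(3) window_set_compl[OF B(2)] by (intro exI[of _ m] exI[of _ "S - B"]) simp
    qed
  next
    case (Union C)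
    show ?case
    proof (intro allI impI)
      fix e :: real assume e: "0 < e"
      have C: "S \<inter> C k \<in> sets M" for k
        using Union.hyps[of k] by (intro inS) (simp add: sets_borel_seq_eq)
      \<comment> \<open>The part of the union missed by its first \<open>N\<close> members; it
        decreases to the empty set, so its measure tends to 0.\<close>
      define D where "D N = (\<Union>k. S \<inter> C k) - (\<Union>k<N. S \<inter> C k)" for N :: nat
      have D: "D N \<in> sets M" for N unfolding D_def using C by blast
      have "decseq D"
        unfolding decseq_def
      proof (intro allI impI)
        fix i j :: nat assume "i \<le> j"
        then show "D j \<le> D i"
          unfolding D_def by (intro Diff_mono order_refl UN_mono) simp_all
      qed
      then have "(\<lambda>N. measure M (D N)) \<longlonglongrightarrow> measure M (\<Inter>N. D N)"
        using D by (intro finite_Lim_measure_decseq) auto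
      moreover have "(\<Inter>N. D N) = {}"
      proof (rule equals0I)
        fix x assume x: "x \<in> (\<Inter>N. D N)"
        then have "x \<in> D 0" by blast
        then obtain k where "x \<in> S \<inter> C k" unfolding D_def by blast
        then have "x \<notin> D (Suc k)" unfolding D_def by blast
        then show False using x by blast
      qed
      ultimately have "(\<lambda>N. measure M (D N)) \<longlonglongrightarrow> 0" by simp
      then have "\<forall>\<^sub>F N in sequentially. measure M (D N) < e / 2"
        using e by (intro order_tendstoD(2)) auto
      then obtain N where N: "measure M (D N) < e / 2"
        by (auto simp: eventually_sequentially)
      \<comment> \<open>Half of \<open>e\<close> pays for the truncation, the other half is shared
        by the \<open>N\<close> members; \<open>N + 1\<close> avoids division by zero.\<close>
      define d where "d = e / (2 * real (N + 1))"
      have "0 < d" using e by (simp add: d_def)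
      then have "\<forall>k. \<exists>m B. B \<in> sets M \<and> window_set S m B \<and>
          measure M ((S \<inter> C k - B) \<union> (B - S \<inter> C k)) < d"
        using Union.IH by blast
      then obtain m B where mB: "\<And>k. B k \<in> sets M" "\<And>k. window_set S (m k) (B k)"
        "\<And>k. measure M ((S \<inter> C k - B k) \<union> (B k - S \<inter> C k)) < d"
        by metis
      define m0 where "m0 = (\<Sum>k<N. m k)"
      have m0: "m k \<le> m0" if "k < N" for k
        unfolding m0_def using that by (intro member_le_sum) auto
      let ?B = "\<Union>k\<in>{..<N}. B k"
      let ?E = "\<lambda>k. (S \<inter> C k - B k) \<union> (B k - S \<inter> C k)"
      have "window_set S m0 ?B"
        using m0 by (intro window_set_UN window_set_mono[OF mB(2)]) simp
      moreover have "?B \<in> sets M" using mB(1) by blast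
      moreover have "measure M ((S \<inter> (\<Union>k. C k) - ?B) \<union> (?B - S \<inter> (\<Union>k. C k))) < e"
      proof -
        have E: "?E k \<in> sets M" for k using C mB(1) by blast
        have "(S \<inter> (\<Union>k. C k) - ?B) \<union> (?B - S \<inter> (\<Union>k. C k)) \<subseteq> D N \<union> (\<Union>k\<in>{..<N}. ?E k)"
          unfolding D_def by blast
        then have "measure M ((S \<inter> (\<Union>k. C k) - ?B) \<union> (?B - S \<inter> (\<Union>k. C k))) \<le>
            measure M (D N \<union> (\<Union>k\<in>{..<N}. ?E k))"
          using D E by (intro finite_measure_mono) blast+
        also have "\<dots> \<le> measure M (D N) + measure M (\<Union>k\<in>{..<N}. ?E k)"
          using D E by (intro measure_Un_le) blast+
        also have "measure M (\<Union>k\<in>{..<N}. ?E k) \<le> (\<Sum>k<N. measure M (?E k))"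
          using E by (intro finite_measure_subadditive_finite) auto
        also have "\<dots> \<le> (\<Sum>k<N. d)" using mB(3) by (intro sum_mono) (simp add: less_imp_le)
        also have "\<dots> \<le> e / 2"
          using e by (simp add: d_def field_simps)
        finally show ?thesis using N by linarith
      qed
      ultimately show "\<exists>m B. B \<in> sets M \<and> window_set S m B \<and>
          measure M ((S \<inter> (\<Union>k. C k) - B) \<union> (B - S \<inter> (\<Union>k. C k))) < e" by blast
    qed
  qed
  moreover obtain C where C: "C \<in> sets borel" "A = S \<inter> C"
    using assms(3) unfolding sets sets_restrict_space by blast
  ultimately show ?thesis using \<open>0 < e\<close> unfolding C(2) sets_borel_seq_eq by blast
qed

subsection \<open>Metric entropy of invariant measures\<close>

lemma word_preimage_in_sets:
  fixes M :: "(int \<Rightarrow> nat) measure"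
  assumes "sets M = sets (restrict_space borel S)"
  shows "{x \<in> S. word x p n = v} \<in> sets M"
proof -
  have "open {x :: int \<Rightarrow> nat. word x p n = v}"
  proof (rule open_finite_window[of "(\<lambda>k. p + int k) ` {..<n}"])
    fix x y :: "int \<Rightarrow> nat"
    assume x: "x \<in> {x. word x p n = v}" and eq: "\<And>i. i \<in> (\<lambda>k. p + int k) ` {..<n} \<Longrightarrow> y i = x i"
    have "word y p n = word x p n" unfolding word_eq_iff using eq by simp
    then show "y \<in> {x. word x p n = v}" using x by simp
  qed simp
  then have "S \<inter> {x. word x p n = v} \<in> sets M"
    unfolding assms sets_restrict_space by (intro imageI) simp
  moreover have "S \<inter> {x. word x p n = v} = {x \<in> S. word x p n = v}" by blast
  ultimately show ?thesis by simp
qed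

text \<open>
  The approximation error, as a random variable: it is \<open>{}\<close> (which is never a cell) where the cell is
  correctly predicted by the window sets \<open>B\<close>, and reveals the cell elsewhere.
\<close>

definition error_symbol :: "'a set set \<Rightarrow> ('a set \<Rightarrow> 'a set) \<Rightarrow> 'a \<Rightarrow> 'a set" where
  "error_symbol P B x = (if \<exists>A\<in>P. x \<in> (A - B A) \<union> (B A - A) then partition_cell P x else {})"

text \<open>Without an error the window sets name the cell, and these see only the window; with an
  error the symbol itself is the cell.\<close>

lemma partition_cell_determined:
  assumes P: "partition_on S P" and B: "\<And>A. A \<in> P \<Longrightarrow> window_set S m (B A)"
    and xy: "x \<in> S" "y \<in> S" "agree_on (window m) x y"
    and err: "error_symbol P B x = error_symbol P B y"
  shows "partition_cell P x = partition_cell P y"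
proof -
  have ne: "partition_cell P z \<noteq> {}" if "z \<in> S" for z
    using partition_cell_in(2)[OF P that] by blast
  \<comment> \<open>Cells are nonempty, so equal symbols cannot arise from an error at one point and
    none at the other.\<close>
  consider "error_symbol P B x = {}" "error_symbol P B y = {}"
    | "error_symbol P B x = partition_cell P x" "error_symbol P B y = partition_cell P y"
    using err ne[OF xy(1)] ne[OF xy(2)] unfolding error_symbol_def by (auto split: if_splits)
  then show ?thesis
  proof cases
    case 1
    let ?A = "partition_cell P x"
    have A: "?A \<in> P" "x \<in> ?A" by (rule partition_cell_in[OF P xy(1)])+
    have good: "\<not> (\<exists>A\<in>P. z \<in> (A - B A) \<union> (B A - A))" if "error_symbol P B z = {}" "z \<in> S" for z
    proof
      assume "\<exists>A\<in>P. z \<in> (A - B A) \<union> (B A - A)"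
      then have "error_symbol P B z = partition_cell P z" unfolding error_symbol_def by (rule if_P)
      then show False using that(1) ne[OF that(2)] by simp
    qed
    have "x \<in> B ?A" using good[OF 1(1) xy(1)] A by blast
    then have "y \<in> B ?A" using window_setD[OF B[OF A(1)] _ xy(2,3)] by blast
    then have "y \<in> ?A" using good[OF 1(2) xy(2)] A(1) by blast
    then show ?thesis using partition_cell_eq[OF P A(1)] by simp
  next
    case 2
    then show ?thesis using err by simp
  qed
qed

lemma simple_function_error_symbol:
  assumes "finite P" "P \<subseteq> sets M" "partition_on (space M) P" "\<And>A. A \<in> P \<Longrightarrow> B A \<in> sets M"
  shows "simple_function M (error_symbol P B)"
proof -
  define Bad where "Bad = (\<Union>A\<in>P. (A - B A) \<union> (B A - A))"
  have Bad: "Bad \<in> sets M" unfolding Bad_def using assms(1,2,4) by (intro sets.finite_UN) auto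
  have eq: "error_symbol P B x = (if x \<in> Bad then partition_cell P x else {})" for x
    by (simp add: error_symbol_def Bad_def)
  have cell: "partition_cell P x = A \<longleftrightarrow> x \<in> A" if "A \<in> P" "x \<in> space M" for A x
    using partition_cell_eq[OF assms(3) that(1)] partition_cell_in[OF assms(3) that(2)] by metis
  have img: "error_symbol P B ` space M \<subseteq> insert {} P"
    using partition_cell_in(1)[OF assms(3)] by (auto simp: eq)
  have pre: "error_symbol P B -` {v} \<inter> space M \<in> sets M" if "v \<in> insert {} P" for v
  proof (cases "v = {}")
    case True
    have "partition_cell P x \<noteq> {}" if "x \<in> space M" for x
      using partition_cell_in(2)[OF assms(3) that] by blast
    then have "error_symbol P B -` {v} \<inter> space M = space M - Bad"
      by (auto simp: eq True)
    then show ?thesis using Bad by auto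
  next
    case False
    then have v: "v \<in> P" using that by simp
    have "v \<subseteq> space M" using assms(2) v sets.sets_into_space by blast
    moreover have "error_symbol P B x = v \<longleftrightarrow> x \<in> Bad \<and> x \<in> v" if "x \<in> space M" for x
      using cell[OF v that] False by (simp add: eq)
    ultimately have "error_symbol P B -` {v} \<inter> space M = Bad \<inter> v" by blast
    then show ?thesis using Bad v assms(2) by auto
  qed
  show ?thesis
    unfolding simple_function_def
  proof (intro conjI ballI)
    show "finite (error_symbol P B ` space M)"
      using assms(1) by (intro finite_subset[OF img]) simp
    show "error_symbol P B -` {v} \<inter> space M \<in> sets M" if "v \<in> error_symbol P B ` space M" for v
      by (rule pre[OF subsetD[OF img that]])
  qed
qed

text \<open>By invariance the error symbol has the same distribution at every time, and entropy is
  subadditive when one more symbol is appended.\<close>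

lemma shannon_entropy_error_names_le:
  assumes "prob_space M" "invariant_measure M T" "simple_function M X" "finite V"
    and range: "\<And>x. x \<in> space M \<Longrightarrow> X x \<in> insert z V"
    and small: "measure M {x \<in> space M. X x \<noteq> z} \<le> d"
  shows "simple_function M (\<lambda>x. map (\<lambda>i. X ((T ^^ i) x)) [0..<n])"
    and "shannon_entropy M (\<lambda>x. map (\<lambda>i. X ((T ^^ i) x)) [0..<n]) \<le>
      real n * (d + real (card V) * (2 * sqrt d))"
proof (induction n)
  interpret prob_space M by fact
  case 0
  show "simple_function M (\<lambda>x. map (\<lambda>i. X ((T ^^ i) x)) [0..<0])" by simp
  then have "shannon_entropy M (\<lambda>x. map (\<lambda>i. X ((T ^^ i) x)) [0..<0]) \<le>
      ln (real (card ((\<lambda>x. map (\<lambda>i. X ((T ^^ i) x)) [0..<0]) ` space M)))"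
    by (rule shannon_entropy_le_card[OF assms(1)])
  also have "(\<lambda>x. map (\<lambda>i. X ((T ^^ i) x)) [0..<0]) ` space M = {[]}"
    using not_empty by auto
  finally show "shannon_entropy M (\<lambda>x. map (\<lambda>i. X ((T ^^ i) x)) [0..<0]) \<le>
      real 0 * (d + real (card V) * (2 * sqrt d))" by simp
next
  case (Suc n)
  have T: "T \<in> measurable M M" using assms(2) by (simp add: invariant_measure_def)
  let ?N = "\<lambda>n x. map (\<lambda>i. X ((T ^^ i) x)) [0..<n]"
  have meas: "X -` {v} \<inter> space M \<in> sets M" for v
    using assms(3) by (rule simple_functionD(2))
  have Xn: "simple_function M (\<lambda>x. X ((T ^^ n) x))"
    unfolding simple_function_def
  proof (intro conjI ballI)
    have "(\<lambda>x. X ((T ^^ n) x)) ` space M \<subseteq> X ` space M"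
      using funpow_in_space[OF T] by blast
    then show "finite ((\<lambda>x. X ((T ^^ n) x)) ` space M)"
      by (rule finite_subset) (rule simple_functionD(1)[OF assms(3)])
    fix v
    have "(\<lambda>x. X ((T ^^ n) x)) -` {v} \<inter> space M = (T ^^ n) -` (X -` {v} \<inter> space M) \<inter> space M"
      using funpow_in_space[OF T] by blast
    then show "(\<lambda>x. X ((T ^^ n) x)) -` {v} \<inter> space M \<in> sets M"
      using measurable_sets[OF measurable_funpow[OF T] meas] by simp
  qed
  have "simple_function M (\<lambda>x. (\<lambda>(l, v). l @ [v]) (?N n x, X ((T ^^ n) x)))"
    using simple_function_compose[OF simple_function_Pair[OF Suc.IH(1) Xn], of "\<lambda>(l, v). l @ [v]"]
    by (simp add: comp_def)
  then show "simple_function M (?N (Suc n))" by simp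
  have X_ne: "{x \<in> space M. X x \<noteq> z} = space M - (X -` {z} \<inter> space M)" by blast
  have "{x \<in> space M. X ((T ^^ n) x) \<noteq> z} = (T ^^ n) -` {x \<in> space M. X x \<noteq> z} \<inter> space M"
    using funpow_in_space[OF T] by blast
  then have "measure M {x \<in> space M. X ((T ^^ n) x) \<noteq> z} = measure M {x \<in> space M. X x \<noteq> z}"
    using measure_funpow_vimage[OF assms(2), of "{x \<in> space M. X x \<noteq> z}" n] meas[of z]
    by (simp add: X_ne)
  then have Hn: "shannon_entropy M (\<lambda>x. X ((T ^^ n) x)) \<le> d + real (card V) * (2 * sqrt d)"
    using range[OF funpow_in_space[OF T]] small
    by (intro shannon_entropy_almost_constant_le[OF assms(1) Xn assms(4), of z]) simp_all
  have "shannon_entropy M (?N (Suc n)) \<le> shannon_entropy M (?N n) + shannon_entropy M (\<lambda>x. X ((T ^^ n) x))"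
    by (rule shannon_entropy_pair_le[OF assms(1) Suc.IH(1) Xn]) simp
  also have "\<dots> \<le> real n * (d + real (card V) * (2 * sqrt d)) + (d + real (card V) * (2 * sqrt d))"
    using Suc.IH(2) Hn by (rule add_mono)
  also have "\<dots> = real (Suc n) * (d + real (card V) * (2 * sqrt d))" by (simp add: algebra_simps)
  finally show "shannon_entropy M (?N (Suc n)) \<le> real (Suc n) * (d + real (card V) * (2 * sqrt d))" .
qed

text \<open>The word over a slightly longer window together with the \<open>n\<close> error symbols
  determines the cell of the join. The word costs at most the logarithm of the number of words, each
  error symbol at most \<open>e\<close>; \<open>m\<close> does not depend on
  \<open>n\<close>.\<close>

lemma static_entropy_le_words:
  fixes M :: "(int \<Rightarrow> nat) measure"
  assumes M: "borel_prob_on S M" "invariant_measure M left_shift"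
    and P: "finite P" "P \<subseteq> sets M" "partition_on S P"
    and fin: "\<And>p n. finite ((\<lambda>x. word x p n) ` S)" and "0 < e"
  shows "\<exists>m. \<forall>n. static_entropy M (dyn_join (space M) left_shift n P) \<le>
    ln (real (card ((\<lambda>x. word x (- int m) (n + (2 * m + 1))) ` S))) + real n * e"
proof -
  have prob: "prob_space M" and sets: "sets M = sets (restrict_space borel S)"
    using M(1) by (auto simp: borel_prob_on_def)
  interpret prob_space M by (rule prob)
  have S_eq: "space M = S"
    using sets_eq_imp_space_eq[OF sets] by (simp add: space_restrict_space)
  have T: "left_shift \<in> measurable M M" using M(2) by (simp add: invariant_measure_def)
  have part: "partition_on (space M) P" using P(3) by (simp add: S_eq)
  define k where "k = real (card P)"
  \<comment> \<open>From \<open>d \<le> 1\<close> one has \<open>d \<le> sqrt d\<close>, hence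
    \<open>d + k * (2 * sqrt d) \<le> (2 * k + 1) * sqrt d \<le> e\<close>.\<close>
  define d where "d = min 1 ((e / (2 * k + 1))\<^sup>2)"
  have k: "0 \<le> k" by (simp add: k_def)
  then have d: "0 < d" "d \<le> 1" "sqrt d \<le> e / (2 * k + 1)"
    using \<open>0 < e\<close> by (auto simp: d_def real_le_lsqrt intro!: real_le_lsqrt)
  have "d \<le> sqrt d" using d by (simp add: real_le_rsqrt power2_eq_square mult_left_le)
  then have "d + k * (2 * sqrt d) \<le> (2 * k + 1) * sqrt d" by (simp add: algebra_simps)
  also have "\<dots> \<le> e" using d(3) k by (simp add: field_simps)
  finally have de: "d + k * (2 * sqrt d) \<le> e" .
  \<comment> \<open>The total error probability \<open>d\<close> is shared among the
    \<open>k\<close> cells; \<open>k + 1\<close> avoids division by zero.\<close>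
  have "0 < d / (k + 1)" using d k by simp
  then have "\<forall>A\<in>P. \<exists>m B. B \<in> sets M \<and> window_set S m B \<and>
      measure M ((A - B) \<union> (B - A)) < d / (k + 1)"
    using window_approximation[OF prob sets] P(2) by blast
  then obtain mm B where B: "\<And>A. A \<in> P \<Longrightarrow> B A \<in> sets M" "\<And>A. A \<in> P \<Longrightarrow> window_set S (mm A) (B A)"
    "\<And>A. A \<in> P \<Longrightarrow> measure M ((A - B A) \<union> (B A - A)) < d / (k + 1)"
    by metis
  define m where "m = (\<Sum>A\<in>P. mm A)"
  have Bm: "window_set S m (B A)" if "A \<in> P" for A
    by (rule window_set_mono[OF B(2)[OF that]]) (use that P(1) in \<open>simp add: m_def member_le_sum\<close>)
  define X where "X = error_symbol P B"
  have X: "simple_function M X"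
    unfolding X_def using B(1) by (rule simple_function_error_symbol[OF P(1,2) part])
  have range: "X x \<in> insert {} P" if "x \<in> space M" for x
    using partition_cell_in(1)[OF part that] by (simp add: X_def error_symbol_def)
  have small: "measure M {x \<in> space M. X x \<noteq> {}} \<le> d"
  proof -
    have E: "(A - B A) \<union> (B A - A) \<in> sets M" if "A \<in> P" for A using that P(2) B(1)[OF that] by blast
    have "{x \<in> space M. X x \<noteq> {}} \<subseteq> (\<Union>A\<in>P. (A - B A) \<union> (B A - A))"
      by (auto simp: X_def error_symbol_def split: if_splits)
    then have "measure M {x \<in> space M. X x \<noteq> {}} \<le> measure M (\<Union>A\<in>P. (A - B A) \<union> (B A - A))"
      using E P(1) by (intro finite_measure_mono sets.finite_UN)
    also have "\<dots> \<le> (\<Sum>A\<in>P. measure M ((A - B A) \<union> (B A - A)))"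
      using E P(1) by (intro finite_measure_subadditive_finite) auto
    also have "\<dots> \<le> (\<Sum>A\<in>P. d / (k + 1))" using B(3) by (intro sum_mono less_imp_le)
    also have "\<dots> \<le> d" using d k by (simp add: k_def field_simps)
    finally show ?thesis .
  qed
  note names = shannon_entropy_error_names_le[OF prob M(2) X P(1) range small]
  have "static_entropy M (dyn_join (space M) left_shift n P) \<le>
      ln (real (card ((\<lambda>x. word x (- int m) (n + (2 * m + 1))) ` S))) + real n * e" for n
  proof -
    let ?W = "\<lambda>x. word x (- int m) (n + (2 * m + 1))"
    let ?E = "\<lambda>x. map (\<lambda>i. X ((left_shift ^^ i) x)) [0..<n]"
    have W: "simple_function M ?W"
      unfolding simple_function_def
    proof (intro conjI ballI)
      show "finite (?W ` space M)" unfolding S_eq by (rule fin)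
      show "?W -` {v} \<inter> space M \<in> sets M" for v
        using word_preimage_in_sets[OF sets, of "- int m" "n + (2 * m + 1)" v]
        by (simp add: S_eq vimage_def Int_def conj_commute)
    qed
    have "static_entropy M (dyn_join (space M) left_shift n P) =
        shannon_entropy M (join_cell (space M) left_shift n P)"
      by (rule static_entropy_dyn_join[OF P(1,2) part T])
    also have "\<dots> \<le> shannon_entropy M ?W + shannon_entropy M ?E"
    proof (rule shannon_entropy_pair_le[OF prob W names(1)])
      fix x y assume xy: "x \<in> space M" "y \<in> space M" and w: "?W x = ?W y" and E: "?E x = ?E y"
      have "partition_cell P ((left_shift ^^ i) y) = partition_cell P ((left_shift ^^ i) x)"
        if "i < n" for i
      proof -
        have "X ((left_shift ^^ i) x) = X ((left_shift ^^ i) y)" using E that by simp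
        then show ?thesis
          using partition_cell_determined[OF P(3) Bm
              funpow_in_space[OF T xy(1), of i, unfolded S_eq]
              funpow_in_space[OF T xy(2), of i, unfolded S_eq] agree_on_shift_window[OF w that]]
          by (simp add: X_def)
      qed
      then show "join_cell (space M) left_shift n P x = join_cell (space M) left_shift n P y"
        using join_cell_eq_iff[OF part T xy, of n] by simp
    qed
    also have "\<dots> \<le> ln (real (card (?W ` S))) + real n * e"
    proof (rule add_mono)
      show "shannon_entropy M ?W \<le> ln (real (card (?W ` S)))"
        using shannon_entropy_le_card[OF prob W] by (simp only: S_eq)
      have "shannon_entropy M ?E \<le> real n * (d + k * (2 * sqrt d))"
        unfolding k_def by (rule names(2))
      also have "\<dots> \<le> real n * e" using de by (intro mult_left_mono) auto
      finally show "shannon_entropy M ?E \<le> real n * e" .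
    qed
    finally show ?thesis .
  qed
  then show ?thesis by blast
qed

lemma metric_entropy_le:
  assumes "2 \<le> \<nu>" "\<tau> \<ge> ln 5 / ln (real \<nu>)" "0 < \<tau>"
    and M: "borel_prob_on (coloured_subshift L \<nu> \<tau>) M" "invariant_measure M left_shift"
  shows "metric_entropy M left_shift \<le> ereal (ln (real \<nu>))"
  unfolding metric_entropy_def
proof (rule SUP_least)
  let ?S = "coloured_subshift L \<nu> \<tau>"
  fix P assume P: "P \<in> {P. finite P \<and> P \<subseteq> sets M \<and> partition_on (space M) P}"
  have "sets M = sets (restrict_space borel ?S)" using M(1) by (simp add: borel_prob_on_def)
  from sets_eq_imp_space_eq[OF this] have S_eq: "space M = ?S"
    by (simp add: space_restrict_space)
  have fin: "finite ((\<lambda>x. word x p n) ` ?S)" for p n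
    using card_subshift_words(1)[OF assms(1-3)] by (simp add: subshift_words_def)
  show "partition_entropy M left_shift P \<le> ereal (ln (real \<nu>))"
  proof (rule ereal_le_epsilon2)
    fix e :: real assume e: "0 < e"
    obtain m where m: "\<And>n. static_entropy M (dyn_join (space M) left_shift n P) \<le>
        ln (real (card (subshift_words L \<nu> \<tau> (- int m) (n + (2 * m + 1))))) + real n * e"
      using static_entropy_le_words[OF M _ _ _ fin e, of P] P
      by (auto simp: S_eq subshift_words_def)
    obtain f where f: "f \<longlonglongrightarrow> ln (real \<nu>)"
      "\<And>n p. ln (real (card (subshift_words L \<nu> \<tau> p (n + (2 * m + 1))))) / real n \<le> f n"
      using subshift_words_growth[OF assms(1-3), of L "2 * m + 1"] by blast
    have "static_entropy M (dyn_join (space M) left_shift n P) / real n \<le> f n + e" for n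
    proof -
      have "static_entropy M (dyn_join (space M) left_shift n P) / real n \<le>
          (ln (real (card (subshift_words L \<nu> \<tau> (- int m) (n + (2 * m + 1))))) + real n * e) / real n"
        by (rule divide_right_mono[OF m]) simp
      also have "\<dots> = ln (real (card (subshift_words L \<nu> \<tau> (- int m) (n + (2 * m + 1))))) / real n +
          real n * e / real n" by (rule add_divide_distrib)
      \<comment> \<open>The last quotient is \<open>e\<close>, except that it is 0 for
        \<open>n = 0\<close>.\<close>
      also have "\<dots> \<le> f n + e" using f(2)[of "- int m" n] e by (cases "n = 0") simp_all
      finally show ?thesis .
    qed
    moreover have "(\<lambda>n. f n + e) \<longlonglongrightarrow> ln (real \<nu>) + e" using f(1) by (intro tendsto_add tendsto_const)
    ultimately show "partition_entropy M left_shift P \<le> ereal (ln (real \<nu>)) + ereal e"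
      unfolding partition_entropy_def plus_ereal.simps(1) by (rule limsup_le_of_tendsto)
  qed
qed

subsection \<open>Independent identically distributed symbols\<close>

definition iid_measure :: "'a pmf \<Rightarrow> (int \<Rightarrow> 'a) measure" where
  "iid_measure p = PiM UNIV (\<lambda>_. measure_pmf p)"

lemma space_iid_measure [simp]: "space (iid_measure p) = UNIV"
  by (simp add: iid_measure_def space_PiM)

lemma prob_space_iid_measure: "prob_space (iid_measure p)"
  unfolding iid_measure_def by (rule prob_space_PiM) (rule prob_space_measure_pmf)

lemma sets_iid_measure [simp]: "sets (iid_measure (p :: nat pmf)) = sets borel"
proof -
  have "sets (iid_measure p) = sets (PiM (UNIV :: int set) (\<lambda>_. borel :: nat measure))"
    unfolding iid_measure_def by (rule sets_PiM_cong) (simp_all add: sets_borel_eq_count_space)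
  then show ?thesis by (simp only: sets_PiM_equal_borel)
qed

lemma measurable_left_shift [measurable]: "left_shift \<in> measurable (iid_measure p) (iid_measure p)"
  unfolding iid_measure_def
proof (rule measurable_PiM_single')
  fix i :: int
  have "(\<lambda>x. x (i + 1)) \<in> measurable (PiM UNIV (\<lambda>_. measure_pmf p)) (measure_pmf p)"
    by (rule measurable_component_singleton) simp
  then show "(\<lambda>x. left_shift x i) \<in> measurable (PiM UNIV (\<lambda>_. measure_pmf p)) (measure_pmf p)"
    by (simp add: left_shift_def)
qed simp

lemma invariant_iid_measure: "invariant_measure (iid_measure p) left_shift"
proof -
  have "distr (PiM UNIV (\<lambda>_. measure_pmf p)) (PiM UNIV (\<lambda>_. measure_pmf p))
      (\<lambda>x. \<lambda>i\<in>UNIV. x (i + 1 :: int)) = PiM UNIV (\<lambda>_. measure_pmf p)"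
    by (rule distr_PiM_reindex[where f = "\<lambda>i. i + 1"]) (simp_all add: prob_space_measure_pmf inj_def)
  then show ?thesis
    using measurable_left_shift[of p]
    by (simp add: invariant_measure_def iid_measure_def left_shift_def[abs_def] restrict_def)
qed

lemma indep_vars_iid_measure:
  "prob_space.indep_vars (iid_measure p) (\<lambda>_. measure_pmf p) (\<lambda>i x. x i) UNIV"
proof -
  interpret prob_space "iid_measure p" by (rule prob_space_iid_measure)
  have comp: "(\<lambda>x. x i) \<in> measurable (iid_measure p) (measure_pmf p)" for i
    unfolding iid_measure_def by (rule measurable_component_singleton) simp
  have d: "distr (iid_measure p) (measure_pmf p) (\<lambda>x. x i) = measure_pmf p" for i
    unfolding iid_measure_def by (rule distr_PiM_component) (simp_all add: prob_space_measure_pmf)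
  have "distr (iid_measure p) (PiM UNIV (\<lambda>_. measure_pmf p)) (\<lambda>x. \<lambda>i\<in>UNIV. x i) = iid_measure p"
    unfolding iid_measure_def[symmetric] by (simp add: restrict_def)
  then show ?thesis
    using comp by (subst indep_vars_iff_distr_eq_PiM) (simp_all add: d[unfolded iid_measure_def] iid_measure_def)
qed

text \<open>A finite product of countable discrete spaces is discrete, so measurability of
  coordinate events is automatic.\<close>

lemma sets_PiM_measure_pmf_finite:
  fixes p :: "nat pmf"
  assumes "finite J" "R \<subseteq> PiE J (\<lambda>_. UNIV)"
  shows "R \<in> sets (PiM J (\<lambda>_. measure_pmf p))"
proof -
  have "sets (PiM J (\<lambda>_. measure_pmf p)) = sets (PiM J (\<lambda>_. count_space (UNIV :: nat set)))"
    by (rule sets_PiM_cong) simp_all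
  also have "\<dots> = sets (count_space (PiE J (\<lambda>_. UNIV :: nat set)))"
    using assms(1) by (subst count_space_PiM_finite) simp_all
  finally show ?thesis using assms(2) by simp
qed

text \<open>For \<open>N > 2 * m\<close> the window and its translate by \<open>N\<close> are
  disjoint, and disjoint families of coordinates are independent.\<close>

lemma iid_measure_mixing:
  fixes p :: "nat pmf"
  assumes B: "\<And>x y. agree_on (window m) x y \<Longrightarrow> x \<in> B \<Longrightarrow> y \<in> B"
    and C: "\<And>x y. agree_on (window m) x y \<Longrightarrow> x \<in> C \<Longrightarrow> y \<in> C"
    and N: "2 * m < N"
  shows "measure (iid_measure p) (B \<inter> (left_shift ^^ N) -` C) =
    measure (iid_measure p) B * measure (iid_measure p) ((left_shift ^^ N) -` C)"
proof -
  interpret prob_space "iid_measure p" by (rule prob_space_iid_measure)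
  let ?J = "window m"
  let ?K = "{int N - int m..int N + int m}"
  \<comment> \<open>The events as sets of restricted sequences, so that \<open>B\<close> and the
    translate of \<open>C\<close> become preimages under the two restriction maps.\<close>
  define RB where "RB = {r \<in> PiE ?J (\<lambda>_. UNIV). \<exists>x\<in>B. agree_on ?J x r}"
  define RC where "RC = {r \<in> PiE ?K (\<lambda>_. UNIV). \<exists>x\<in>C. agree_on ?J x (\<lambda>i. r (i + int N))}"
  have "restrict x ?J \<in> RB \<longleftrightarrow> x \<in> B" for x
  proof
    assume "restrict x ?J \<in> RB"
    then obtain y where "y \<in> B" "agree_on ?J y (restrict x ?J)" unfolding RB_def by blast
    then have "agree_on ?J y x" by (simp add: agree_on_def)
    then show "x \<in> B" using \<open>y \<in> B\<close> by (rule B)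
  next
    assume "x \<in> B"
    moreover have "agree_on ?J x (restrict x ?J)" by (simp add: agree_on_def)
    moreover have "restrict x ?J \<in> PiE ?J (\<lambda>_. UNIV)" by (rule restrict_PiE_iff[THEN iffD2]) simp
    ultimately show "restrict x ?J \<in> RB" unfolding RB_def by blast
  qed
  then have RB: "(\<lambda>x. restrict x ?J) -` RB = B" by blast
  have "restrict x ?K \<in> RC \<longleftrightarrow> (left_shift ^^ N) x \<in> C" for x
  proof
    assume "restrict x ?K \<in> RC"
    then obtain y where y: "y \<in> C" "agree_on ?J y (\<lambda>i. restrict x ?K (i + int N))"
      unfolding RC_def by blast
    then have "agree_on ?J y ((left_shift ^^ N) x)" by (simp add: agree_on_def left_shift_funpow)
    then show "(left_shift ^^ N) x \<in> C" using y(1) by (rule C)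
  next
    assume "(left_shift ^^ N) x \<in> C"
    moreover have "agree_on ?J ((left_shift ^^ N) x) (\<lambda>i. restrict x ?K (i + int N))"
      by (simp add: agree_on_def left_shift_funpow)
    moreover have "restrict x ?K \<in> PiE ?K (\<lambda>_. UNIV)" by (rule restrict_PiE_iff[THEN iffD2]) simp
    ultimately show "restrict x ?K \<in> RC" unfolding RC_def by blast
  qed
  then have RC: "(\<lambda>x. restrict x ?K) -` RC = (left_shift ^^ N) -` C" by blast
  have disj: "?J \<inter> ?K = {}" using N by auto
  have "indep_var (PiM ?J (\<lambda>_. measure_pmf p)) (\<lambda>x. restrict (\<lambda>i. x i) ?J)
      (PiM ?K (\<lambda>_. measure_pmf p)) (\<lambda>x. restrict (\<lambda>i. x i) ?K)"
    by (rule indep_var_restrict[OF indep_vars_iid_measure disj]) simp_all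
  from indep_varD[OF this, of RB RC]
  have "prob ((\<lambda>x. (restrict x ?J, restrict x ?K)) -` (RB \<times> RC)) =
      prob ((\<lambda>x. restrict x ?J) -` RB) * prob ((\<lambda>x. restrict x ?K) -` RC)"
    by (simp add: sets_PiM_measure_pmf_finite RB_def RC_def)
  moreover have "(\<lambda>x. (restrict x ?J, restrict x ?K)) -` (RB \<times> RC) =
      (\<lambda>x. restrict x ?J) -` RB \<inter> (\<lambda>x. restrict x ?K) -` RC" by blast
  ultimately show ?thesis by (simp only: RB RC)
qed

lemma measure_iid_cylinder:
  "measure (iid_measure p) {x. \<forall>i<n. x (int i) = a i} = (\<Prod>i<n. pmf p (a i))"
proof -
  interpret product_prob_space "\<lambda>_. measure_pmf p" "UNIV :: int set"
    by (simp add: product_prob_space_def product_sigma_finite_def product_prob_space_axioms_def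
        prob_space_measure_pmf prob_space_imp_sigma_finite)
  have "{x :: int \<Rightarrow> 'a. \<forall>i<n. x (int i) = a i} =
      {x \<in> space (PiM UNIV (\<lambda>_. measure_pmf p)). \<forall>i\<in>int ` {..<n}. x i \<in> {a (nat i)}}"
    by (auto simp: space_PiM)
  then have "emeasure (iid_measure p) {x. \<forall>i<n. x (int i) = a i} =
      (\<Prod>i\<in>int ` {..<n}. emeasure (measure_pmf p) {a (nat i)})"
    unfolding iid_measure_def by (simp only:) (rule emeasure_PiM_Collect, simp_all)
  also have "\<dots> = (\<Prod>i<n. ennreal (pmf p (a i)))"
    by (subst prod.reindex) (simp_all add: emeasure_pmf_single)
  also have "\<dots> = ennreal (\<Prod>i<n. pmf p (a i))" by (rule prod_ennreal) simp
  finally show ?thesis by (simp add: measure_def prod_nonneg)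
qed

section \<open>Bernoulli measures carried by a closed subshift\<close>

locale iid_on_subshift =
  fixes p :: "nat pmf" and S :: "(int \<Rightarrow> nat) set"
  assumes closed: "closed S" and shift: "\<And>x. x \<in> S \<Longrightarrow> left_shift x \<in> S"
    and full: "\<And>x. (\<And>i. x i \<in> set_pmf p) \<Longrightarrow> x \<in> S"
begin

text \<open>Restricting makes \<open>S\<close> the underlying space, as \<open>borel_prob_on\<close>
  demands; no mass is lost, because \<open>S\<close> has full measure.\<close>

definition \<mu> :: "(int \<Rightarrow> nat) measure" where
  "\<mu> = restrict_space (iid_measure p) S"

lemma S_borel: "S \<in> sets borel"
  using closed by (rule borel_closed)

lemma sets_mu: "sets \<mu> = sets (restrict_space borel S)"
  by (simp add: \<mu>_def sets_restrict_space)

lemma space_mu: "space \<mu> = S"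
  by (simp add: \<mu>_def space_restrict_space)

text \<open>Each coordinate lies almost surely in the support of \<open>p\<close>, and there are
  only countably many coordinates.\<close>

lemma AE_in_S: "AE x in iid_measure p. x \<in> S"
proof -
  have "AE x in iid_measure p. x i \<in> set_pmf p" for i
    unfolding iid_measure_def
    by (rule AE_PiM_component) (simp_all add: prob_space_measure_pmf AE_measure_pmf)
  then have "AE x in iid_measure p. \<forall>i. x i \<in> set_pmf p" by (simp add: AE_all_countable)
  then show ?thesis by (rule eventually_mono) (use full in blast)
qed

lemma emeasure_mu:
  assumes "A \<subseteq> S"
  shows "emeasure \<mu> A = emeasure (iid_measure p) A"
  unfolding \<mu>_def using S_borel assms by (intro emeasure_restrict_space) auto

lemma sets_mu_iff: "A \<in> sets \<mu> \<longleftrightarrow> A \<subseteq> S \<and> A \<in> sets borel"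
  unfolding \<mu>_def using S_borel by (subst sets_restrict_space_iff) auto

lemma emeasure_Int_S:
  assumes "A \<in> sets borel"
  shows "emeasure (iid_measure p) (S \<inter> A) = emeasure (iid_measure p) A"
proof (rule emeasure_eq_AE)
  show "AE x in iid_measure p. x \<in> S \<inter> A \<longleftrightarrow> x \<in> A" using AE_in_S by (rule eventually_mono) blast
qed (use assms S_borel in auto)

lemma measure_mu_Int:
  assumes "A \<in> sets borel"
  shows "measure \<mu> (S \<inter> A) = measure (iid_measure p) A"
  using emeasure_Int_S[OF assms] emeasure_mu[of "S \<inter> A"] by (simp add: measure_def)

lemma prob_space_mu: "prob_space \<mu>"
proof (rule prob_spaceI)
  interpret prob_space "iid_measure p" by (rule prob_space_iid_measure)
  have "emeasure \<mu> S = emeasure (iid_measure p) (S \<inter> UNIV)" by (simp add: emeasure_mu)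
  also have "\<dots> = emeasure (iid_measure p) UNIV" by (rule emeasure_Int_S) simp
  also have "\<dots> = 1" using emeasure_space_1 by simp
  finally show "emeasure \<mu> (space \<mu>) = 1" by (simp add: space_mu)
qed

lemma borel_prob_mu: "borel_prob_on S \<mu>"
  by (simp add: borel_prob_on_def prob_space_mu sets_mu)

lemma measurable_shift_mu: "left_shift \<in> measurable \<mu> \<mu>"
  unfolding \<mu>_def by (rule measurable_restrict_space3[OF measurable_left_shift]) (use shift in blast)

lemma invariant_mu: "invariant_measure \<mu> left_shift"
  unfolding invariant_measure_def
proof (intro conjI measurable_shift_mu)
  show "distr \<mu> \<mu> left_shift = \<mu>"
  proof (rule measure_eqI)
    fix A assume "A \<in> sets (distr \<mu> \<mu> left_shift)"
    then have A: "A \<in> sets \<mu>" "A \<subseteq> S" "A \<in> sets borel" by (auto simp: sets_mu_iff)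
    have pre: "left_shift -` A \<in> sets borel"
      using measurable_sets[OF measurable_left_shift[of p], of A] A(3) by simp
    have "emeasure (distr \<mu> \<mu> left_shift) A = emeasure \<mu> (S \<inter> left_shift -` A)"
      by (simp add: emeasure_distr[OF measurable_shift_mu A(1)] space_mu Int_commute)
    also have "\<dots> = emeasure (iid_measure p) (left_shift -` A)"
      by (simp add: emeasure_mu emeasure_Int_S[OF pre])
    also have "\<dots> = emeasure (distr (iid_measure p) (iid_measure p) left_shift) A"
      using A(3) by (subst emeasure_distr) simp_all
    also have "\<dots> = emeasure \<mu> A"
      using invariant_iid_measure[of p] A(2) by (simp add: invariant_measure_def emeasure_mu)
    finally show "emeasure (distr \<mu> \<mu> left_shift) A = emeasure \<mu> A" .
  qed simp
qed

text \<open>A window set of \<open>S\<close> is the trace of a set \<open>C\<close> of the whole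
  sequence space that depends on the same window; mixing is inherited from the product
  measure.\<close>

lemma mixing_window_set:
  assumes "window_set S m B" "2 * m < N"
  shows "measure \<mu> (B \<inter> (left_shift ^^ N) -` B) = (measure \<mu> B)\<^sup>2"
proof -
  define C where "C = {y. \<exists>x\<in>B. agree_on (window m) x y}"
  have C: "y \<in> C" if xy: "agree_on (window m) x y" and "x \<in> C" for x y
  proof -
    obtain z where z: "z \<in> B" "agree_on (window m) z x" using \<open>x \<in> C\<close> unfolding C_def by blast
    then show ?thesis using agree_on_trans[OF z(2) xy] unfolding C_def by blast
  qed
  have "open C"
  proof (rule open_finite_window[of "window m"])
    fix x y assume x: "x \<in> C" and eq: "\<And>i. i \<in> window m \<Longrightarrow> y i = x i"
    have "agree_on (window m) x y" by (rule agree_onI) (simp only: eq)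
    then show "y \<in> C" using x by (rule C)
  qed simp
  then have "C \<in> sets borel" by (rule borel_open)
  then have pre: "(left_shift ^^ N) -` C \<in> sets borel"
    using measurable_sets[OF measurable_funpow[OF measurable_left_shift[of p]], of C N] by simp
  have "B \<subseteq> S" using assms(1) by (simp add: window_set_def)
  have B: "B = S \<inter> C"
  proof (intro equalityI subsetI)
    fix x assume "x \<in> B"
    moreover have "agree_on (window m) x x" by (simp add: agree_on_def)
    ultimately show "x \<in> S \<inter> C" using \<open>B \<subseteq> S\<close> unfolding C_def by blast
  next
    fix x assume "x \<in> S \<inter> C"
    then show "x \<in> B" using window_setD[OF assms(1)] unfolding C_def by blast
  qed
  have shiftN: "(left_shift ^^ N) x \<in> S" if "x \<in> S" for x
    using funpow_in_space[OF measurable_shift_mu, of x N] that by (simp add: space_mu)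
  have "B \<inter> (left_shift ^^ N) -` B = S \<inter> (C \<inter> (left_shift ^^ N) -` C)"
    unfolding B using shiftN by blast
  then have "measure \<mu> (B \<inter> (left_shift ^^ N) -` B) =
      measure (iid_measure p) (C \<inter> (left_shift ^^ N) -` C)"
    using \<open>C \<in> sets borel\<close> pre by (simp only: measure_mu_Int sets.Int)
  also have "\<dots> = measure (iid_measure p) C * measure (iid_measure p) ((left_shift ^^ N) -` C)"
    by (rule iid_measure_mixing[OF C C assms(2)])
  also have "measure (iid_measure p) ((left_shift ^^ N) -` C) = measure (iid_measure p) C"
    using measure_funpow_vimage[OF invariant_iid_measure[of p], of C N] \<open>C \<in> sets borel\<close> by simp
  also have "measure (iid_measure p) C = measure \<mu> B"
    unfolding B by (simp only: measure_mu_Int[OF \<open>C \<in> sets borel\<close>])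
  finally show ?thesis by (simp only: power2_eq_square)
qed

text \<open>
  An invariant set is approximated by a window set \<open>B\<close>, which is independent of its translate by
  more than the window length; hence an invariant set is independent of itself.
\<close>

lemma ergodic_mu: "ergodic_measure \<mu> left_shift"
  unfolding ergodic_measure_def
proof (intro conjI ballI impI invariant_mu)
  interpret prob_space \<mu> by (rule prob_space_mu)
  fix A assume A: "A \<in> sets \<mu>" and "left_shift -` A \<inter> space \<mu> = A"
  then have inv: "left_shift -` A \<inter> S = A" by (simp add: space_mu)
  have "A \<subseteq> S" using A by (simp add: sets_mu_iff)
  have shiftS: "(left_shift ^^ i) x \<in> S" if "x \<in> S" for x i
    using funpow_in_space[OF measurable_shift_mu, of x i] that by (simp add: space_mu)
  have invN: "(left_shift ^^ i) x \<in> A \<longleftrightarrow> x \<in> A" if "x \<in> S" for x i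
  proof (induction i)
    case (Suc i)
    have "left_shift ((left_shift ^^ i) x) \<in> A \<longleftrightarrow> (left_shift ^^ i) x \<in> A"
      using inv shiftS[OF that, of i] by blast
    then show ?case using Suc.IH by simp
  qed simp
  \<comment> \<open>Replacing \<open>A\<close>, which equals its intersection with its own
    translate, by the approximation \<open>B\<close> in both places costs 2e; passing from the
    square of \<open>prob B\<close> to that of \<open>prob A\<close> costs another 2e.\<close>
  have key: "\<bar>prob A - (prob A)\<^sup>2\<bar> \<le> 4 * e" if e: "0 < e" for e
  proof -
    obtain m B where B: "B \<in> sets \<mu>" "window_set S m B" "prob ((A - B) \<union> (B - A)) < e"
      using window_approximation[OF prob_space_mu sets_mu A e] by blast
    let ?D = "(A - B) \<union> (B - A)"
    define N where "N = 2 * m + 1"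
    let ?pre = "\<lambda>E. (left_shift ^^ N) -` E \<inter> S"
    have "B \<subseteq> S" using B(2) by (simp add: window_set_def)
    have D: "?D \<in> sets \<mu>" using A B(1) by blast
    have pre: "?pre E \<in> sets \<mu>" if "E \<in> sets \<mu>" for E
      using measurable_sets[OF measurable_funpow[OF measurable_shift_mu] that, of N] by (simp only: space_mu)
    have preD: "prob (?pre ?D) = prob ?D"
      using measure_funpow_vimage[OF invariant_mu D, of N] by (simp only: space_mu)
    have diff: "\<bar>prob E - prob F\<bar> \<le> prob G"
      if "E \<in> sets \<mu>" "F \<in> sets \<mu>" "G \<in> sets \<mu>" "E \<subseteq> F \<union> G" "F \<subseteq> E \<union> G" for E F G
    proof -
      have "prob E \<le> prob (F \<union> G)" "prob F \<le> prob (E \<union> G)"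
        using that by (simp_all add: finite_measure_mono)
      moreover have "prob (F \<union> G) \<le> prob F + prob G" "prob (E \<union> G) \<le> prob E + prob G"
        using that by (simp_all add: measure_Un_le)
      ultimately show ?thesis by linarith
    qed
    have BN: "B \<inter> (left_shift ^^ N) -` B = B \<inter> ?pre B" using \<open>B \<subseteq> S\<close> by blast
    have "\<bar>prob A - prob (B \<inter> ?pre B)\<bar> \<le> prob (?D \<union> ?pre ?D)"
    proof (rule diff)
      show "A \<subseteq> B \<inter> ?pre B \<union> (?D \<union> ?pre ?D)" using invN \<open>A \<subseteq> S\<close> by blast
    qed (use A B(1) D pre in blast)+
    also have "\<dots> \<le> prob ?D + prob (?pre ?D)" using D pre[OF D] by (rule measure_Un_le)
    also have "\<dots> \<le> 2 * e" using B(3) preD by linarith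
    finally have 0: "\<bar>prob A - prob (B \<inter> ?pre B)\<bar> \<le> 2 * e" .
    have 1: "\<bar>prob A - (prob B)\<^sup>2\<bar> \<le> 2 * e"
    proof -
      have "prob (B \<inter> (left_shift ^^ N) -` B) = (prob B)\<^sup>2"
        by (rule mixing_window_set[OF B(2)]) (simp add: N_def)
      then show ?thesis using 0 by (simp only: BN)
    qed
    have AB: "\<bar>prob B - prob A\<bar> \<le> prob ?D" by (rule diff) (use A B(1) D in blast)+
    have "(prob B)\<^sup>2 - (prob A)\<^sup>2 = (prob B - prob A) * (prob B + prob A)"
      by (simp add: power2_eq_square algebra_simps)
    then have "\<bar>(prob B)\<^sup>2 - (prob A)\<^sup>2\<bar> = \<bar>prob B - prob A\<bar> * \<bar>prob B + prob A\<bar>"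
      by (simp only: abs_mult)
    also have "\<dots> \<le> e * 2"
    proof (rule mult_mono)
      have "prob A \<le> 1" "prob B \<le> 1" "0 \<le> prob A" "0 \<le> prob B" by simp_all
      then show "\<bar>prob B + prob A\<bar> \<le> 2" by linarith
    qed (use AB B(3) e in auto)
    finally show ?thesis using 1 by linarith
  qed
  have "\<bar>prob A - (prob A)\<^sup>2\<bar> \<le> 0"
  proof (rule field_le_epsilon)
    fix e :: real assume "0 < e"
    then show "\<bar>prob A - (prob A)\<^sup>2\<bar> \<le> 0 + e" using key[of "e / 4"] by simp
  qed
  then have "prob A * (1 - prob A) = 0" by (simp add: power2_eq_square algebra_simps)
  then show "prob A = 0 \<or> prob A = 1" by simp
qed

section \<open>Lower bounds for both entropies\<close>

text \<open>It serves both as a measurable partition and as an open cover. Symbols that never occur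
  would give empty cells, which \<open>partition_on\<close> forbids.\<close>

definition symbol_partition :: "(int \<Rightarrow> nat) set set" where
  "symbol_partition = range (\<lambda>a. {x \<in> S. x 0 = a}) - {{}}"

lemma partition_on_symbol_partition: "partition_on S symbol_partition"
proof (rule partition_onI)
  show "\<Union>symbol_partition = S" by (auto simp: symbol_partition_def)
  show "disjnt A B" if h: "A \<in> symbol_partition" "B \<in> symbol_partition" "A \<noteq> B" for A B
  proof -
    obtain a b where "A = {x \<in> S. x 0 = a}" "B = {x \<in> S. x 0 = b}"
      using h(1,2) unfolding symbol_partition_def by blast
    then show ?thesis using h(3) by (auto simp: disjnt_def)
  qed
qed (simp add: symbol_partition_def)

text \<open>A member of the join is a cylinder over \<open>n\<close> consecutive coordinates, so its
  measure is a product of \<open>n\<close> probabilities, each 0 or \<open>c\<close>.\<close>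

lemma measure_symbol_join:
  assumes "A \<in> dyn_join S left_shift n symbol_partition" "\<And>a. pmf p a \<in> {0, c}"
  shows "A \<in> sets \<mu>" "measure \<mu> A = 0 \<or> measure \<mu> A = c ^ n"
proof -
  obtain s where s: "A = {x \<in> S. \<forall>i<n. (left_shift ^^ i) x \<in> s i}" "\<forall>i<n. s i \<in> symbol_partition"
    using assms(1) unfolding dyn_join_def by blast
  have "\<exists>a. i < n \<longrightarrow> s i = {x \<in> S. x 0 = a}" for i
  proof (cases "i < n")
    case True
    then have "s i \<in> symbol_partition" using s(2) by simp
    then show ?thesis unfolding symbol_partition_def by blast
  qed simp
  then obtain a where a: "\<And>i. i < n \<Longrightarrow> s i = {x \<in> S. x 0 = a i}" by metis
  let ?C = "{x :: int \<Rightarrow> nat. \<forall>i<n. x (int i) = a i}"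
  have "(left_shift ^^ i) x \<in> S" if "x \<in> S" for x i
    using funpow_in_space[OF measurable_shift_mu, of x i] that by (simp add: space_mu)
  then have A: "A = S \<inter> ?C" unfolding s(1) using a by (auto simp: left_shift_funpow)
  have "open ?C" by (rule open_finite_window[of "int ` {..<n}"]) auto
  then have C: "?C \<in> sets borel" by (rule borel_open)
  show "A \<in> sets \<mu>" unfolding A using C S_borel by (simp add: sets_mu_iff)
  have m: "measure \<mu> A = (\<Prod>i<n. pmf p (a i))"
    unfolding A measure_mu_Int[OF C] by (rule measure_iid_cylinder)
  show "measure \<mu> A = 0 \<or> measure \<mu> A = c ^ n"
  proof (cases "\<exists>i<n. pmf p (a i) = 0")
    case True
    then have "(\<Prod>i<n. pmf p (a i)) = 0" by (intro prod_zero) auto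
    then show ?thesis using m by simp
  next
    case False
    then have "(\<Prod>i<n. pmf p (a i)) = (\<Prod>i<n. c)" using assms(2) by (intro prod.cong) auto
    then show ?thesis using m by simp
  qed
qed

lemma Union_dyn_join_symbol: "\<Union>(dyn_join S left_shift n symbol_partition) = S"
proof (intro equalityI subsetI)
  fix x assume x: "x \<in> S"
  have "x \<in> join_cell S left_shift n symbol_partition x"
    using join_cell_eq_iff(1)[of \<mu> symbol_partition left_shift x x n] x
      partition_on_symbol_partition measurable_shift_mu by (simp add: space_mu)
  moreover have "join_cell S left_shift n symbol_partition x \<in> dyn_join S left_shift n symbol_partition"
    using dyn_join_vs_join_cell(1)[of \<mu> symbol_partition left_shift n] x
      partition_on_symbol_partition measurable_shift_mu by (auto simp: space_mu)
  ultimately show "x \<in> \<Union>(dyn_join S left_shift n symbol_partition)" by blast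
qed (auto simp: dyn_join_def)

text \<open>The members cover a space of measure 1 and each has measure at most k^(-n). The first
  claim is used for metric entropy, the second for topological entropy.\<close>

lemma symbol_cover_bound:
  assumes "\<And>a. pmf p a \<in> {0, 1 / real k}" "2 \<le> k"
    and V: "V \<subseteq> dyn_join S left_shift n symbol_partition" "finite V" "\<Union>V = S"
  shows "1 \<le> (\<Sum>A\<in>V. measure \<mu> A)" "k ^ n \<le> card V"
proof -
  interpret prob_space \<mu> by (rule prob_space_mu)
  note mV = measure_symbol_join[OF subsetD[OF V(1)] assms(1)]
  have "1 = prob (\<Union>A\<in>V. A)" using V(3) prob_space by (simp add: space_mu)
  also have "\<dots> \<le> (\<Sum>A\<in>V. prob A)"
    using mV(1) V(2) by (intro finite_measure_subadditive_finite) auto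
  finally show 1: "1 \<le> (\<Sum>A\<in>V. measure \<mu> A)" .
  also have "\<dots> \<le> (\<Sum>A\<in>V. (1 / real k) ^ n)"
  proof (rule sum_mono)
    fix A assume "A \<in> V"
    from mV(2)[OF this] show "prob A \<le> (1 / real k) ^ n" by auto
  qed
  also have "\<dots> = real (card V) / real k ^ n" by (simp add: power_one_over)
  finally have "real k ^ n \<le> real (card V)" using assms(2) by (simp add: field_simps)
  then show "k ^ n \<le> card V" by (metis of_nat_le_iff of_nat_power)
qed

lemma metric_entropy_ge:
  assumes "\<And>a. pmf p a \<in> {0, 1 / real k}" "2 \<le> k" "finite symbol_partition"
  shows "ereal (ln (real k)) \<le> metric_entropy \<mu> left_shift"
proof -
  have "symbol_partition \<subseteq> sets \<mu>"
  proof
    fix A assume "A \<in> symbol_partition"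
    then obtain a where A: "A = S \<inter> {x. x 0 = a}" unfolding symbol_partition_def by blast
    have "open {x :: int \<Rightarrow> nat. x 0 = a}" by (rule open_finite_window[of "{0}"]) auto
    then show "A \<in> sets \<mu>" unfolding A using S_borel by (simp add: sets_mu_iff borel_open)
  qed
  then have in_P: "symbol_partition \<in> {P. finite P \<and> P \<subseteq> sets \<mu> \<and> partition_on (space \<mu>) P}"
    using assms(3) partition_on_symbol_partition by (simp add: space_mu)
  have "real n * ln (real k) \<le> static_entropy \<mu> (dyn_join S left_shift n symbol_partition)" for n
  proof -
    let ?V = "dyn_join S left_shift n symbol_partition"
    \<comment> \<open>A cell of measure \<open>(1 / real k) ^ n\<close> has information exactly
      \<open>n * ln k\<close>; null cells contribute 0.\<close>
    have "- (measure \<mu> A * ln (measure \<mu> A)) = measure \<mu> A * (real n * ln (real k))" if "A \<in> ?V" for A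
      using measure_symbol_join(2)[OF that assms(1)] assms(2)
      by (auto simp: ln_realpow ln_div)
    then have "static_entropy \<mu> ?V = (\<Sum>A\<in>?V. measure \<mu> A) * (real n * ln (real k))"
      by (simp add: static_entropy_def sum_distrib_right flip: sum_negf)
    moreover have "1 * (real n * ln (real k)) \<le> (\<Sum>A\<in>?V. measure \<mu> A) * (real n * ln (real k))"
      using assms(2) symbol_cover_bound(1)[OF assms(1,2) order_refl finite_dyn_join[OF assms(3)]
          Union_dyn_join_symbol]
      by (intro mult_right_mono) simp_all
    ultimately show ?thesis by simp
  qed
  then have "ereal (ln (real k)) \<le>
      ereal (static_entropy \<mu> (dyn_join (space \<mu>) left_shift n symbol_partition) / real n)"
    if "1 \<le> n" for n using that by (simp add: space_mu field_simps)
  then have "ereal (ln (real k)) \<le> partition_entropy \<mu> left_shift symbol_partition"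
    unfolding partition_entropy_def
    by (intro le_Limsup eventually_sequentiallyI[of 1]) simp_all
  also have "\<dots> \<le> metric_entropy \<mu> left_shift"
    unfolding metric_entropy_def using in_P by (rule SUP_upper)
  finally show ?thesis .
qed

lemma topological_entropy_ge:
  assumes "\<And>a. pmf p a \<in> {0, 1 / real k}" "2 \<le> k" "finite symbol_partition"
  shows "ereal (ln (real k)) \<le> topological_entropy S left_shift"
proof -
  have "open_cover S symbol_partition"
    unfolding open_cover_def
  proof (intro conjI ballI)
    fix A assume "A \<in> symbol_partition"
    then obtain a where A: "A = S \<inter> {x. x 0 = a}" unfolding symbol_partition_def by blast
    have "open {x :: int \<Rightarrow> nat. x 0 = a}" by (rule open_finite_window[of "{0}"]) auto
    then show "openin (top_of_set S) A" unfolding A by (rule openin_open_Int)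
  next
    show "\<Union>symbol_partition = S" using partition_on_symbol_partition by (simp add: partition_on_def)
  qed
  then have in_U: "symbol_partition \<in> {U. open_cover S U}" by simp
  have "real n * ln (real k) \<le> ln (real (min_subcover_card S (dyn_join S left_shift n symbol_partition)))" for n
  proof -
    obtain W where W: "W \<subseteq> dyn_join S left_shift n symbol_partition" "finite W"
      "card W = min_subcover_card S (dyn_join S left_shift n symbol_partition)" "\<Union>W = S"
      by (rule min_subcover_card_attained[OF order_refl finite_dyn_join[OF assms(3)] Union_dyn_join_symbol])
    have "k ^ n \<le> card W" by (rule symbol_cover_bound(2)[OF assms(1,2) W(1,2,4)])
    then have "ln (real (k ^ n)) \<le> ln (real (card W))"
      using assms(2) by (intro ln_mono) simp_all
    then show ?thesis using assms(2) by (simp add: W(3) ln_realpow)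
  qed
  then have "ereal (ln (real k)) \<le>
      ereal (ln (real (min_subcover_card S (dyn_join S left_shift n symbol_partition))) / real n)"
    if "1 \<le> n" for n using that by (simp add: field_simps)
  then have "ereal (ln (real k)) \<le> cover_entropy S left_shift symbol_partition"
    unfolding cover_entropy_def
    by (intro le_Limsup eventually_sequentiallyI[of 1]) simp_all
  also have "\<dots> \<le> topological_entropy S left_shift"
    unfolding topological_entropy_def using in_U by (rule SUP_upper)
  finally show ?thesis .
qed

end

section \<open>The measures of maximal entropy, one for each colour\<close>

lemma iid_on_coloured_subshift:
  assumes "0 < \<tau>" "1 \<le> \<nu>" "j \<in> {1..L}"
  shows "iid_on_subshift (pmf_of_set (colour_symbols \<nu> j)) (coloured_subshift L \<nu> \<tau>)"
proof
  show "closed (coloured_subshift L \<nu> \<tau>)" by (rule closed_coloured_subshift[OF assms(1)])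
  show "left_shift x \<in> coloured_subshift L \<nu> \<tau>" if "x \<in> coloured_subshift L \<nu> \<tau>" for x
    by (rule left_shift_in_coloured_subshift[OF assms(1) that])
  fix x :: "int \<Rightarrow> nat" assume x: "\<And>i. x i \<in> set_pmf (pmf_of_set (colour_symbols \<nu> j))"
  have "card (colour_symbols \<nu> j) \<noteq> 0" using card_colour_symbols[of j \<nu>] assms(2,3) by simp
  then have "colour_symbols \<nu> j \<noteq> {}" by auto
  then have "set_pmf (pmf_of_set (colour_symbols \<nu> j)) = colour_symbols \<nu> j"
    by (rule set_pmf_of_set) simp
  then have "x \<in> full_colour_shift \<nu> j" using x by (simp add: full_colour_shift_def)
  then show "x \<in> coloured_subshift L \<nu> \<tau>" using full_colour_shift_subset[OF assms(1,3)] by blast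
qed

theorem mainTheorem4:
  fixes L \<nu> :: nat and \<tau> :: real
  assumes "L \<ge> 2" and "\<nu> \<ge> 2" and "\<tau> \<ge> ln 5 / ln (real \<nu>)"
  shows "\<exists>\<M> :: (int \<Rightarrow> nat) measure set. finite \<M> \<and> card \<M> = L \<and>
           (\<forall>\<mu>\<in>\<M>. measure_of_maximal_entropy (coloured_subshift L \<nu> \<tau>) left_shift \<mu> \<and>
                   ergodic_measure \<mu> left_shift)"
proof -
  let ?S = "coloured_subshift L \<nu> \<tau>"
  have "0 < ln 5 / ln (real \<nu>)" using assms(2) by simp
  then have tau: "0 < \<tau>" using assms(3) by linarith
  define C where "C j = colour_symbols \<nu> j" for j
  have finC: "finite (C j)" for j by (simp add: C_def)
  have cardC: "card (C j) = \<nu>" if "j \<in> {1..L}" for j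
    using card_colour_symbols[of j \<nu>] that by (simp add: C_def)
  have neC: "C j \<noteq> {}" if "j \<in> {1..L}" for j using cardC[OF that] assms(2) by auto
  define p where "p j = pmf_of_set (C j)" for j
  have iid: "iid_on_subshift (p j) ?S" if "j \<in> {1..L}" for j
    unfolding p_def C_def using iid_on_coloured_subshift[OF tau _ that] assms(2) by simp
  have pmf: "pmf (p j) a \<in> {0, 1 / real \<nu>}" if "j \<in> {1..L}" for j a
    unfolding p_def using neC[OF that] finC cardC[OF that] by (simp add: indicator_def)
  define m where "m j = iid_on_subshift.\<mu> (p j) ?S" for j
  \<comment> \<open>The partition depends only on the subshift, not on the Bernoulli measure; colour
    1 supplies an instance of the locale.\<close>
  have fin: "finite (iid_on_subshift.symbol_partition ?S)"
  proof -
    have "1 \<in> {1..L}" using assms(1) by simp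
    interpret iid_on_subshift "p 1" ?S by (rule iid) fact
    have "symbol_partition \<subseteq> (\<lambda>a. {x \<in> ?S. x 0 = a}) ` {..L * \<nu>}"
    proof
      fix A assume "A \<in> symbol_partition"
      then obtain a x where A: "A = {x \<in> ?S. x 0 = a}" "x \<in> ?S" "x 0 = a"
        unfolding symbol_partition_def by blast
      then have "a \<le> L * \<nu>" using locally_admissibleD(1) coloured_subshift_iff[OF tau] by blast
      then show "A \<in> (\<lambda>a. {x \<in> ?S. x 0 = a}) ` {..L * \<nu>}" using A(1) by blast
    qed
    then show ?thesis by (rule finite_subset) simp
  qed
  have mme: "measure_of_maximal_entropy ?S left_shift (m j) \<and> ergodic_measure (m j) left_shift"
    if j: "j \<in> {1..L}" for j
  proof -
    interpret iid_on_subshift "p j" ?S by (rule iid[OF j])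
    have "metric_entropy \<mu> left_shift = ereal (ln (real \<nu>))"
      using metric_entropy_le[OF assms(2,3) tau borel_prob_mu invariant_mu]
        metric_entropy_ge[OF pmf[OF j] assms(2) fin] by (rule antisym)
    moreover have "topological_entropy ?S left_shift = ereal (ln (real \<nu>))"
      using topological_entropy_le[OF assms(2,3) tau]
        topological_entropy_ge[OF pmf[OF j] assms(2) fin] by (rule antisym)
    ultimately show ?thesis
      unfolding m_def measure_of_maximal_entropy_def
      using borel_prob_mu invariant_mu ergodic_mu by simp
  qed
  \<comment> \<open>The colour at coordinate 0 tells the measures apart: under \<open>m j\<close> it
    is almost surely \<open>j\<close>.\<close>
  have charge: "measure (m j) (?S \<inter> {x. x 0 \<in> C i}) = (if i = j then 1 else 0)"
    if "i \<in> {1..L}" and j: "j \<in> {1..L}" for i j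
  proof -
    interpret iid_on_subshift "p j" ?S by (rule iid[OF j])
    have "open {x :: int \<Rightarrow> nat. x 0 \<in> C i}" by (rule open_finite_window[of "{0}"]) auto
    then have "measure (m j) (?S \<inter> {x. x 0 \<in> C i}) = measure (iid_measure (p j)) {x. x 0 \<in> C i}"
      unfolding m_def by (intro measure_mu_Int borel_open)
    also have "\<dots> = measure (distr (iid_measure (p j)) (measure_pmf (p j)) (\<lambda>x. x 0)) (C i)"
      by (subst measure_distr) (simp_all add: iid_measure_def space_PiM vimage_def)
    also have "\<dots> = measure (measure_pmf (p j)) (C i)"
      unfolding iid_measure_def by (subst distr_PiM_component) (simp_all add: prob_space_measure_pmf)
    also have "\<dots> = real (card (C j \<inter> C i)) / real (card (C j))"
      unfolding p_def by (rule measure_pmf_of_set[OF neC[OF j] finC])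
    also have "\<dots> = (if i = j then 1 else 0)"
    proof (cases "i = j")
      case False
      then have "C j \<inter> C i = {}"
        using colour_symbols_disjoint[of _ \<nu> i j] that by (auto simp: C_def)
      then show ?thesis using False by simp
    qed (use cardC[OF j] assms(2) in simp)
    finally show ?thesis .
  qed
  have "inj_on m {1..L}"
  proof (rule inj_onI)
    fix i j assume i: "i \<in> {1..L}" and j: "j \<in> {1..L}" and "m i = m j"
    then have "(if i = i then 1 else 0 :: real) = (if i = j then 1 else 0)"
      using charge[OF i i] charge[OF i j] by simp
    then show "i = j" by (simp split: if_splits)
  qed
  then have "card (m ` {1..L}) = L" by (simp add: card_image)
  moreover have "\<forall>\<mu>\<in>m ` {1..L}. measure_of_maximal_entropy ?S left_shift \<mu> \<and>
      ergodic_measure \<mu> left_shift"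
  proof
    fix \<mu> assume "\<mu> \<in> m ` {1..L}"
    then obtain j where "j \<in> {1..L}" "\<mu> = m j" by blast
    then show "measure_of_maximal_entropy ?S left_shift \<mu> \<and> ergodic_measure \<mu> left_shift"
      using mme[of j] by simp
  qed
  ultimately show ?thesis by (intro exI[of _ "m ` {1..L}"] conjI finite_imageI finite_atLeastAtMost)
qed

end
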